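(* For positive integers $a,b,c$ with $a\le b$, let $$f^{a,b}_c(x,y,z,w)=ax^2+by^2+c(z^2+zw+w^2),\qquad x,y,z,w\in\mathbb{Z}.$$ (1) $f^{a,b}_c$ represents every nonnegative integer if and only if $(a,b,c)$ is one of: $(1,b,1)$ with $b\in\{1,2,3,4,5,6\}$; $(2,b,1)$ with $b\in\{2,3,4,5,6,7,8,9,10\}$; $(1,b,2)$ with $b\in\{1,2,3,4,5\}$; $(1,2,3)$; $(1,2,4)$. (2) If $f^{a,b}_c$ represents each of $n=1,2,3,5,6,10$, then it represents every nonnegative integer.
   Context: A form $f$ "represents" an integer $n$ if $n=f(x,y,z,w)$ for some integers $x,y,z,w$. *)

theory Defs
  imports Main
begin

definition f_form :: "int \<Rightarrow> int \<Rightarrow> int \<Rightarrow> int \<Rightarrow> int \<Rightarrow> int \<Rightarrow> int \<Rightarrow> int" where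
  "f_form a b c x y z w = a * x^2 + b * y^2 + c * (z^2 + z * w + w^2)"

definition represents :: "int \<Rightarrow> int \<Rightarrow> int \<Rightarrow> int \<Rightarrow> bool" where
  "represents a b c n \<longleftrightarrow> (\<exists>x y z w. n = f_form a b c x y z w)"

definition universal :: "int \<Rightarrow> int \<Rightarrow> int \<Rightarrow> bool" where
  "universal a b c \<longleftrightarrow> (\<forall>n::int. n \<ge> 0 \<longrightarrow> represents a b c n)"

end

theory Submission
  imports Defs "HOL-Number_Theory.Number_Theory"
    "HOL-Computational_Algebra.Squarefree"
begin

text \<open>
  With N(z, w) = z^2 + zw + w^2, the ternary form x^2 + N represents every n >= 0 that 3 does not divide,
  and 2x^2 + N every n >= 0 with 4 not dividing n and n mod 16 different from 10. Subtracting suitable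
  values of the remaining variable from n then settles each form of the list, while the numbers
  1, 2, 3, 5, 6, 10 exclude all other forms.

  For a ternary form a x^2 + N and squarefree m one picks a prime q with (q/3) = 1, so that q is a
  rational value of N, for which Legendre's theorem (by the pigeonhole principle) solves
  a x^2 + q r^2 = m t^2. This yields a rational representation of m, and the Davenport-Cassels descent
  makes it integral. The conditions on q only prescribe q mod 8 and Legendre symbols of q at finitely
  many primes, so only real characters are needed to find it: L(1, \<chi>) is nonzero by Monsky's argument
  with Lambert series, hence the sums of \<chi>(n) \<Lambda>(n) / n are bounded, whereas the
  sum of \<Lambda>(n) / n diverges.
\<close>

section \<open>Primes with prescribed values of real characters\<close>

text \<open>Legendre's theorem handles three squares, but a x^2 + N(z, w) = m t^2 has four
  variables; freezing N to q r^2 closes the gap, at the price of finding a prime q with prescribed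
  symbols. Every condition on q is a sign, so a weight detecting "all signs right" expands into
  products of real characters. The descent needs every rational point to have a lattice point at
  which the form of the difference is below 1: rounding gives a/4 + 7/16, which is 15/16 for a = 2
  but exceeds 1 for a = 3. Hence only a = 1 and a = 2 are treated, and the remaining listed forms
  are reduced to these two. The excluded residues reflect genuine gaps: x^2 + N misses 6 and 2x^2 +
  N misses 10, which is how these two numbers enter the list of test values. Multiples of 4 are
  recovered in the quaternary forms by doubling all variables.\<close>

lemma abel_summation_bound:
  fixes f b :: "nat \<Rightarrow> real"
  assumes f: "\<And>k. \<bar>\<Sum>n=m..<k. f n\<bar> \<le> B"
    and dec: "\<And>n. m \<le> n \<Longrightarrow> b (Suc n) \<le> b n"
    and nonneg: "\<And>n. m \<le> n \<Longrightarrow> 0 \<le> b n"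
  shows "\<bar>\<Sum>n=m..<k. f n * b n\<bar> \<le> B * b m"
proof (cases "m \<le> k")
  case True
  define F where "F k = (\<Sum>n=m..<k. f n)" for k
  have parts: "(\<Sum>n=m..<k. f n * b n) = F k * b k + (\<Sum>n=m..<k. F (Suc n) * (b n - b (Suc n)))"
    using True by (induction k rule: dec_induct) (simp_all add: F_def algebra_simps)
  have tele: "(\<Sum>n=m..<k. B * (b n - b (Suc n))) = B * (b m - b k)"
    using True by (induction k rule: dec_induct) (simp_all add: algebra_simps)
  have "0 \<le> B" using f[of m] by simp
  then have "\<bar>\<Sum>n=m..<k. F (Suc n) * (b n - b (Suc n))\<bar> \<le> (\<Sum>n=m..<k. B * (b n - b (Suc n)))"
    using f dec by (intro sum_abs[THEN order_trans] sum_mono)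
      (auto simp: abs_mult F_def simp del: sum.op_ivl_Suc intro!: mult_mono)
  moreover have "\<bar>F k * b k\<bar> \<le> B * b k"
    using f[of k] nonneg[OF True] by (auto simp: abs_mult F_def intro!: mult_right_mono)
  ultimately show ?thesis
    unfolding parts tele by (auto simp: algebra_simps)
next
  case False
  then show ?thesis
    using f[of m] nonneg[of m] by simp
qed

section \<open>Chebyshev's bound and the lower half of Mertens' first theorem\<close>

lemma sum_divisors_swap:
  fixes F :: "nat \<Rightarrow> nat \<Rightarrow> real"
  shows "(\<Sum>n=1..N. \<Sum>d | d dvd n. F d (n div d)) = (\<Sum>d=1..N. \<Sum>k=1..N div d. F d k)"
proof -
  have "(\<Sum>n=1..N. \<Sum>d | d dvd n. F d (n div d)) =
      (\<Sum>(n, d)\<in>Sigma {1..N} (\<lambda>n. {d. d dvd n}). F d (n div d))"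
    by (rule sum.Sigma) auto
  also have "\<dots> = (\<Sum>(d, k)\<in>Sigma {1..N} (\<lambda>d. {1..N div d}). F d k)"
    by (rule sum.reindex_bij_witness[where j = "\<lambda>(n, d). (d, n div d)" and i = "\<lambda>(d, k). (d * k, d)"])
       (auto simp: Suc_le_eq div_le_mono dvd_div_eq_0_iff less_eq_div_iff_mult_less_eq mult.commute
         intro!: Nat.gr0I intro: order_trans[OF dvd_imp_le])
  also have "\<dots> = (\<Sum>d=1..N. \<Sum>k=1..N div d. F d k)"
    by (rule sum.Sigma[symmetric]) auto
  finally show ?thesis .
qed

text \<open>Legendre's formula for N! in logarithmic form: d divides exactly \<open>N div d\<close>
  of the numbers up to N.\<close>

lemma ln_fact_eq_sum_mangoldt: "ln (fact N) = (\<Sum>d=1..N. mangoldt d * real (N div d))"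
proof -
  have "ln (fact N :: real) = (\<Sum>n=1..N. ln (real n))"
    unfolding fact_prod of_nat_prod by (subst ln_prod) auto
  also have "\<dots> = (\<Sum>n=1..N. \<Sum>d | d dvd n. mangoldt d)"
    by (intro sum.cong) (auto simp: mangoldt_sum)
  also have "\<dots> = (\<Sum>d=1..N. \<Sum>k=1..N div d. mangoldt d)"
    by (rule sum_divisors_swap)
  also have "\<dots> = (\<Sum>d=1..N. mangoldt d * real (N div d))"
    by (simp add: mult.commute)
  finally show ?thesis .
qed

lemma psi_double_le: "(\<Sum>d=1..2*n. mangoldt d) \<le> (\<Sum>d=1..n. mangoldt d) + 2 * real n * ln 2"
proof -
  have split: "(\<Sum>d=1..2*n. h d) = (\<Sum>d=1..n. h d) + (\<Sum>d=Suc n..2*n. h d)" for h :: "nat \<Rightarrow> real"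
    by (rule sum.ub_add_nat[of 1 n h n, simplified mult_2[symmetric], unfolded Suc_eq_plus1[symmetric]]) simp
  \<comment> \<open>Chebyshev's argument: the sum of h is the logarithm of the central binomial coefficient.\<close>
  define h :: "nat \<Rightarrow> real" where "h d = mangoldt d * (real (2 * n div d) - 2 * real (n div d))" for d
  have h_nonneg: "0 \<le> h d" for d
  proof -
    have "2 * (n div d) \<le> 2 * n div d"
      by (cases "d = 0") (simp_all add: less_eq_div_iff_mult_less_eq)
    hence "real (2 * (n div d)) \<le> real (2 * n div d)"
      by (rule of_nat_mono)
    thus ?thesis unfolding h_def by (intro mult_nonneg_nonneg mangoldt_nonneg) simp
  qed
  have h_eq: "h d = mangoldt d" if d: "d \<in> {Suc n..2*n}" for d
  proof -
    have "2 * n div d = 1" using d by (intro div_nat_eqI) auto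
    moreover have "n div d = 0" using d by simp
    ultimately show ?thesis by (simp add: h_def)
  qed
  have trunc: "(\<Sum>d=1..2*n. mangoldt d * real (n div d)) = (\<Sum>d=1..n. mangoldt d * real (n div d))"
    by (rule sum.mono_neutral_right) auto
  have "(\<Sum>d=Suc n..2*n. mangoldt d) = (\<Sum>d=Suc n..2*n. h d)"
    by (intro sum.cong) (simp_all add: h_eq)
  also have "\<dots> \<le> (\<Sum>d=1..2*n. h d)"
    unfolding split[of h] using h_nonneg by (simp add: sum_nonneg)
  also have "\<dots> = (\<Sum>d=1..2*n. mangoldt d * real (2 * n div d)) - 2 * (\<Sum>d=1..2*n. mangoldt d * real (n div d))"
    by (simp add: h_def algebra_simps sum_subtractf sum_distrib_left)
  also have "\<dots> = ln (fact (2 * n)) - 2 * ln (fact n)"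
    unfolding trunc ln_fact_eq_sum_mangoldt by (rule refl)
  finally have 1: "(\<Sum>d=Suc n..2*n. mangoldt d) \<le> ln (fact (2 * n)) - 2 * ln (fact n :: real)" .
  have "real ((2 * n) choose n) = fact (2 * n) / (fact n * fact n)"
    by (subst binomial_fact) (auto simp: mult_2)
  hence "ln (fact (2 * n)) - 2 * ln (fact n :: real) = ln (real ((2 * n) choose n))"
    by (simp add: ln_div ln_mult)
  also have "\<dots> \<le> ln (real (2 ^ (2 * n)))"
    using binomial_le_pow2[of "2 * n" n]
    by (subst ln_le_cancel_iff) (auto simp del: of_nat_power simp: of_nat_le_iff)
  also have "\<dots> = 2 * real n * ln 2"
    by (simp add: ln_realpow)
  finally show ?thesis using 1 unfolding split[of mangoldt] by simp
qed

lemma psi_mono: "N \<le> N' \<Longrightarrow> (\<Sum>d=1..N. mangoldt d) \<le> (\<Sum>d=1..N'. mangoldt d :: real)"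
  by (rule sum_mono2) (auto intro: mangoldt_nonneg)

text \<open>Halving N through n = (N + 1) div 2, with ln 2 rounded up to 1, gives 6n + 2n = 8n <=
  4(N + 1), which is at most 6N as soon as N >= 2; the constant 6 comes from here.\<close>

lemma psi_le: "(\<Sum>d=1..N. mangoldt d) \<le> 6 * real N"
proof (induction N rule: less_induct)
  case (less N)
  show ?case
  proof (cases "N \<le> 1")
    case True
    then have "N = 0 \<or> N = 1" by auto
    then show ?thesis by auto
  next
    case False
    define n where "n = (N + 1) div 2"
    have n: "n < N" "N \<le> 2 * n" "2 * n \<le> N + 1" using False by (auto simp: n_def)
    have "(\<Sum>d=1..N. mangoldt d) \<le> (\<Sum>d=1..2*n. mangoldt d :: real)"
      by (rule psi_mono) (use n in auto)
    also have "\<dots> \<le> (\<Sum>d=1..n. mangoldt d) + 2 * real n * ln 2" by (rule psi_double_le)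
    also have "\<dots> \<le> 6 * real n + 2 * real n * 1"
      using ln_2_less_1 by (intro add_mono less.IH n mult_left_mono) auto
    also have "\<dots> \<le> 6 * real N" using n False by linarith
    finally show ?thesis .
  qed
qed

text \<open>The crude half of Stirling's formula; the induction step rests on n ln(1 + 1/n) <=
  1.\<close>

lemma ln_fact_ge: "real n * ln (real n) - real n \<le> ln (fact n)"
proof (induction n)
  case (Suc n)
  show ?case
  proof (cases "n = 0")
    case False
    have "ln (real (Suc n)) - ln (real n) = ln (1 + 1 / real n)"
      using False by (subst ln_divide_pos[symmetric]) (auto simp: add_divide_distrib add.commute)
    also have "\<dots> \<le> 1 / real n" by (rule ln_add_one_self_le_self) simp
    finally have "real n * (ln (real (Suc n)) - ln (real n)) \<le> 1"
      using False by (simp add: field_simps)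
    with Suc have "real n * ln (real (Suc n)) \<le> 1 + real n + ln (fact n)"
      by (simp add: algebra_simps)
    moreover have "ln (fact (Suc n) :: real) = ln (real (Suc n)) + ln (fact n)"
      by (subst fact_Suc, subst ln_mult) auto
    ultimately show ?thesis by (simp add: algebra_simps)
  qed auto
qed auto

text \<open>Replacing \<open>N div d\<close> by N/d in the formula for ln N! only enlarges the
  sum.\<close>

lemma sum_mangoldt_over_n_ge:
  assumes "N > 0"
  shows "ln (real N) - 1 \<le> (\<Sum>d=1..N. mangoldt d / real d)"
proof -
  have "real N * (ln (real N) - 1) \<le> (\<Sum>d=1..N. mangoldt d * real (N div d))"
    using ln_fact_ge[of N] by (simp add: ln_fact_eq_sum_mangoldt algebra_simps)
  also have "\<dots> \<le> (\<Sum>d=1..N. mangoldt d * (real N / real d))"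
    by (intro sum_mono mult_left_mono mangoldt_nonneg) (simp add: of_nat_div_le_of_nat)
  also have "\<dots> = real N * (\<Sum>d=1..N. mangoldt d / real d)"
    by (simp add: sum_distrib_left mult.commute)
  finally show ?thesis using assms by simp
qed

section \<open>Nonprincipal real characters and the value L(1, chi)\<close>

locale real_character =
  fixes \<chi> :: "nat \<Rightarrow> real" and M :: nat
  assumes M_pos: "0 < M"
    and one: "\<chi> (Suc 0) = 1"
    and mult: "\<chi> (a * b) = \<chi> a * \<chi> b"
    and vals: "\<chi> a \<in> {-1, 0, 1}"
    and periodic: "\<chi> (a + M) = \<chi> a"
    and sum_period: "(\<Sum>n<M. \<chi> n) = 0"
begin

lemma abs_le_1: "\<bar>\<chi> a\<bar> \<le> 1"
  using vals[of a] by auto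

lemma partial_sum_periodic: "(\<Sum>n<k+M. \<chi> n) = (\<Sum>n<k. \<chi> n)"
  by (induction k) (simp_all add: sum_period periodic)

lemma abs_partial_sum_le: "\<bar>\<Sum>n<k. \<chi> n\<bar> \<le> real M"
proof (induction k rule: less_induct)
  case (less k)
  show ?case
  proof (cases "k < M")
    case True
    have "\<bar>\<Sum>n<k. \<chi> n\<bar> \<le> (\<Sum>n<k. 1)"
      by (intro sum_abs[THEN order_trans] sum_mono abs_le_1)
    thus ?thesis using True by simp
  next
    case False
    hence "(\<Sum>n<k. \<chi> n) = (\<Sum>n<k-M. \<chi> n)"
      using partial_sum_periodic[of "k - M"] by simp
    thus ?thesis using less[of "k - M"] False M_pos by simp
  qed
qed

lemma abs_sum_interval_le: "\<bar>\<Sum>n=m..<k. \<chi> n\<bar> \<le> 2 * real M"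
proof (cases "m \<le> k")
  case True
  hence "(\<Sum>n<k. \<chi> n) = (\<Sum>n<m. \<chi> n) + (\<Sum>n=m..<k. \<chi> n)"
    by (metis atLeast0LessThan sum.atLeastLessThan_concat zero_le)
  thus ?thesis using abs_partial_sum_le[of k] abs_partial_sum_le[of m] by linarith
qed auto

lemma abs_sum_weighted_le:
  assumes "\<And>n. m \<le> n \<Longrightarrow> b (Suc n) \<le> b n" "\<And>n. m \<le> n \<Longrightarrow> 0 \<le> b n"
  shows "\<bar>\<Sum>n=m..<k. \<chi> n * b n\<bar> \<le> 2 * real M * b m"
  by (rule abel_summation_bound[where f = \<chi> and m = m and b = b and B = "2 * real M"])
     (use abs_sum_interval_le assms in auto)

lemma abs_sum_over_n_le:
  assumes "m > 0"
  shows "\<bar>\<Sum>n=m..<k. \<chi> n / real n\<bar> \<le> 2 * real M / real m"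
  using abs_sum_weighted_le[of m "\<lambda>n. 1 / real n" k] assms by (simp add: frac_le)

definition L1 :: real where "L1 = lim (\<lambda>N. \<Sum>n=1..N. \<chi> n / real n)"

text \<open>Later steps use the rate O(1/N), beyond convergence: it makes the main term of
  \<open>lambert_le\<close> vanish as N grows, and in \<open>sum_mangoldt_bounded\<close> it bounds
  the error at \<open>N div d\<close> by a multiple of d/N.\<close>

lemma abs_partial_sum_minus_L1_le: "\<bar>(\<Sum>n=1..N. \<chi> n / real n) - L1\<bar> \<le> 2 * real M / real (Suc N)"
proof -
  let ?S = "\<lambda>N. \<Sum>n=1..N. \<chi> n / real n"
  have diff: "\<bar>?S m - ?S k\<bar> \<le> 2 * real M / real (Suc m)" if "m \<le> k" for m k
  proof -
    have "?S k = ?S m + (\<Sum>n=Suc m..<Suc k. \<chi> n / real n)"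
      using that by (induction k rule: dec_induct) auto
    thus ?thesis using abs_sum_over_n_le[of "Suc m" "Suc k"] by linarith
  qed
  have "Cauchy ?S"
  proof (rule metric_CauchyI)
    fix e :: real assume "e > 0"
    define n0 where "n0 = nat \<lceil>2 * real M / e\<rceil>"
    have small: "2 * real M / real (Suc m) < e" if "m \<ge> n0" for m
    proof -
      have "2 * real M / e < real (Suc m)" using that unfolding n0_def by linarith
      thus ?thesis using \<open>e > 0\<close> by (simp add: field_simps)
    qed
    have "dist (?S m) (?S k) < e" if "m \<ge> n0" "k \<ge> n0" for m k
      using diff[of m k] diff[of k m] small[OF that(1)] small[OF that(2)]
      by (cases "m \<le> k") (auto simp: dist_real_def abs_minus_commute)
    thus "\<exists>n0. \<forall>m\<ge>n0. \<forall>k\<ge>n0. dist (?S m) (?S k) < e" by blast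
  qed
  hence "?S \<longlonglongrightarrow> L1"
    unfolding L1_def using Cauchy_convergent convergent_LIMSEQ_iff by blast
  hence "(\<lambda>k. \<bar>?S N - ?S k\<bar>) \<longlonglongrightarrow> \<bar>?S N - L1\<bar>"
    by (intro tendsto_intros)
  thus ?thesis
    by (rule LIMSEQ_le_const2) (use diff in blast)
qed

text \<open>The Dirichlet convolution of chi with 1. These are the coefficients of the Lambert
  series: sum of chi(d) x^d/(1 - x^d) = sum of \<open>conv_one n\<close> x^n.\<close>

definition conv_one :: "nat \<Rightarrow> real" where "conv_one n = (\<Sum>d | d dvd n. \<chi> d)"

lemma power: "\<chi> (a ^ k) = \<chi> a ^ k"
  by (induction k) (simp_all add: one mult)

lemma conv_one_prime_power:
  assumes "prime p"
  shows "conv_one (p ^ k) = (\<Sum>i\<le>k. \<chi> p ^ i)"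
proof -
  have "conv_one (p ^ k) = (\<Sum>d\<in>(\<lambda>i. p ^ i) ` {..k}. \<chi> d)"
    unfolding conv_one_def using assms
    by (intro sum.cong) (auto simp: divides_primepow_nat)
  also have "\<dots> = (\<Sum>i\<le>k. \<chi> p ^ i)"
    using prime_gt_1_nat[OF assms] by (subst sum.reindex) (auto simp: inj_on_def power)
  finally show ?thesis .
qed

lemma conv_one_coprime_mult:
  assumes "coprime a b" "a > 0" "b > 0"
  shows "conv_one (a * b) = conv_one a * conv_one b"
proof -
  have gcds: "gcd (c * d) a = c" "gcd (c * d) b = d" if cd: "c dvd a" "d dvd b" for c d
  proof -
    have "coprime d a" "coprime c b"
      using coprime_divisors[of c a d b] coprime_divisors[of c a b b] coprime_divisors[of a a d b] assms(1) cd
      by (auto simp: coprime_commute)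
    with cd show "gcd (c * d) a = c" "gcd (c * d) b = d"
      by (simp_all add: gcd_mult_left_right_cancel gcd_mult_left_left_cancel coprime_commute gcd_nat.absorb1)
  qed
  have "conv_one a * conv_one b = (\<Sum>(c, d)\<in>{c. c dvd a} \<times> {d. d dvd b}. \<chi> (c * d))"
    unfolding conv_one_def by (simp add: sum_product sum.cartesian_product mult)
  also have "\<dots> = conv_one (a * b)"
    unfolding conv_one_def
  proof (rule sum.reindex_bij_witness[where j = "\<lambda>(c, d). c * d" and i = "\<lambda>n. (gcd n a, gcd n b)"])
    fix n assume "n \<in> {d. d dvd a * b}"
    then obtain c d where n: "n = c * d" and cd: "c dvd a" "d dvd b"
      using division_decomp[of n a b] by auto
    show "(case (gcd n a, gcd n b) of (c, d) \<Rightarrow> c * d) = n"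
      using gcds[OF cd] by (simp add: n)
  next
    fix p assume "p \<in> {c. c dvd a} \<times> {d. d dvd b}"
    then obtain c d where p: "p = (c, d)" and cd: "c dvd a" "d dvd b" by auto
    show "(gcd (case p of (c, d) \<Rightarrow> c * d) a, gcd (case p of (c, d) \<Rightarrow> c * d) b) = p"
      using gcds[OF cd] by (simp add: p)
  qed (auto intro: mult_dvd_mono)
  finally show ?thesis by simp
qed

text \<open>For chi(p) = 1, 0, -1 the sum up to k is k + 1, 1, or the indicator of even k. Squares
  have only even exponents, whence the second bound.\<close>

lemma geometric_sum_nonneg: "0 \<le> (\<Sum>i\<le>k. \<chi> p ^ i)"
  and geometric_sum_even_ge_1: "1 \<le> (\<Sum>i\<le>2*k. \<chi> p ^ i)"
proof -
  have "(\<Sum>i\<le>k. (-1::real) ^ i) = (if even k then 1 else 0)" for k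
    by (induction k) auto
  moreover have "(\<Sum>i\<le>k. (0::real) ^ i) = 1" for k
    by (induction k) auto
  ultimately show "0 \<le> (\<Sum>i\<le>k. \<chi> p ^ i)" "1 \<le> (\<Sum>i\<le>2*k. \<chi> p ^ i)"
    using vals[of p] by (auto simp: add_nonneg_nonneg)
qed

lemma prime_power_split:
  assumes "n > (1::nat)"
  obtains p k m where "prime p" "n = p ^ k * m" "\<not> p dvd m" "0 < m" "m < n"
proof -
  obtain p where p: "prime p" "p dvd n" using assms prime_factor_nat[of n] by auto
  obtain m where m: "n = p ^ multiplicity p n * m" "\<not> p dvd m"
    using multiplicity_decompose'[of n p] p assms by (metis not_prime_unit not_one_less_zero)
  have "multiplicity p n > 0" using p assms by (simp add: prime_multiplicity_gt_zero_iff)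
  hence "1 < p ^ multiplicity p n"  using prime_gt_1_nat[OF p(1)] by (intro one_less_power) auto
  moreover have "0 < m" using m assms by (metis gr0I mult_0_right not_one_less_zero)
  ultimately have "m < n" by (subst m) simp
  with that p m \<open>0 < m\<close> show ?thesis by blast
qed

lemma conv_one_nonneg: "n > 0 \<Longrightarrow> 0 \<le> conv_one n"
proof (induction n rule: less_induct)
  case (less n)
  show ?case
  proof (cases "n = 1")
    case True thus ?thesis by (simp add: conv_one_def one)
  next
    case False
    with less.prems have "n > 1" by simp
    then obtain p k m where n: "prime p" "n = p ^ k * m" "\<not> p dvd m" "0 < m" "m < n"
      by (rule prime_power_split)
    have "coprime (p ^ k) m" using n by (simp add: prime_imp_coprime)
    thus ?thesis
      using n less.IH[of m] geometric_sum_nonneg[where k = k and p = p]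
      by (simp add: conv_one_coprime_mult conv_one_prime_power prime_gt_0_nat)
  qed
qed

lemma conv_one_square_ge_1: "r > 0 \<Longrightarrow> 1 \<le> conv_one (r ^ 2)"
proof (induction r rule: less_induct)
  case (less r)
  show ?case
  proof (cases "r = 1")
    case True thus ?thesis by (simp add: conv_one_def one)
  next
    case False
    with less.prems have "r > 1" by simp
    then obtain p k m where n: "prime p" "r = p ^ k * m" "\<not> p dvd m" "0 < m" "m < r"
      by (rule prime_power_split)
    have "coprime (p ^ (2 * k)) (m ^ 2)" using n by (simp add: prime_imp_coprime)
    moreover have "r ^ 2 = p ^ (2 * k) * m ^ 2" using n by (simp add: power_mult_distrib power_mult mult.commute)
    moreover have "1 * 1 \<le> (\<Sum>i\<le>2 * k. \<chi> p ^ i) * conv_one (m ^ 2)"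
      using geometric_sum_even_ge_1[where k = k and p = p] less.IH[of m] n by (intro mult_mono) auto
    ultimately show ?thesis
      using n by (simp add: conv_one_coprime_mult conv_one_prime_power prime_gt_0_nat)
  qed
qed

end

section \<open>Lambert series and the nonvanishing of L(1, chi)\<close>

lemma geometric_sum_ge:
  fixes y :: real
  assumes "0 \<le> y"
  shows "real (Suc n) * y ^ n \<le> (\<Sum>i<Suc n. (y\<^sup>2) ^ i)"
proof -
  \<comment> \<open>AM-GM for the terms i and n - i, whose product is y^(2n).\<close>
  have "2 * y ^ n \<le> (y\<^sup>2) ^ i + (y\<^sup>2) ^ (n - i)" if "i < Suc n" for i
  proof -
    have "y ^ n = y ^ i * y ^ (n - i)" using that by (simp flip: power_add)
    moreover have "0 \<le> (y ^ i - y ^ (n - i))\<^sup>2" by simp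
    ultimately show ?thesis
      by (simp add: power2_diff power_mult[symmetric] mult_ac)
  qed
  hence "(\<Sum>i<Suc n. 2 * y ^ n) \<le> (\<Sum>i<Suc n. (y\<^sup>2) ^ i + (y\<^sup>2) ^ (n - i))"
    by (intro sum_mono) simp
  also have "\<dots> = (\<Sum>i<Suc n. (y\<^sup>2) ^ i) + (\<Sum>i<Suc n. (y\<^sup>2) ^ (Suc n - Suc i))"
    by (simp only: sum.distrib diff_Suc_Suc)
  also have "(\<Sum>i<Suc n. (y\<^sup>2) ^ (Suc n - Suc i)) = (\<Sum>i<Suc n. (y\<^sup>2) ^ i)"
    by (rule sum.nat_diff_reindex)
  finally show ?thesis by simp
qed

text \<open>Replacing x^n/(1 - x^n) by 1/(n(1 - x)) in the Lambert series of \<chi> turns it into L(1, \<chi>)/(1 - x);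
  the differences decrease in n, so by partial summation the error stays bounded as x tends to 1.\<close>

definition monsky :: "real \<Rightarrow> nat \<Rightarrow> real"
  where "monsky x n = 1 / (real n * (1 - x)) - x ^ n / (1 - x ^ n)"

lemma monsky_eq:
  assumes "0 < x" "x < 1" "n > 0"
  shows "monsky x n = (1 / real n - x ^ n / (\<Sum>i<n. x ^ i)) / (1 - x)"
proof -
  have "1 - x ^ n = (1 - x) * (\<Sum>i<n. x ^ i)"
    by (rule one_diff_power_eq)
  thus ?thesis using assms by (simp add: monsky_def diff_divide_distrib mult.commute)
qed

text \<open>Put s(n) = 1 + x + ... + x^(n-1). Since s(n+1) = 1 + x s(n), the quotient x^n/s(n) drops
  by x^n/(s(n) s(n+1)) from n to n + 1, to be compared with 1/n - 1/(n+1). This amounts to n(n+1)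
  x^n <= s(n) s(n+1). With y = sqrt x, \<open>geometric_sum_ge\<close> bounds the right side below
  by n(n+1) y^(2n-1), and y^(2n-1) >= y^(2n) = x^n.\<close>

lemma monsky_decreasing:
  assumes x: "0 < x" "x < 1" and n: "n > 0"
  shows "monsky x (Suc n) \<le> monsky x n"
proof -
  define s where "s n = (\<Sum>i<n. x ^ i)" for n
  define y where "y = sqrt x"
  have y: "0 < y" "y < 1" "x = y\<^sup>2" using x by (auto simp: y_def)
  obtain k where k: "n = Suc k" using n gr0_implies_Suc by blast
  have s1: "real n * y ^ k \<le> s n"
    using geometric_sum_ge[of y k] y unfolding s_def k by simp
  have s2: "real (Suc n) * y ^ n \<le> s (Suc n)"
    using geometric_sum_ge[of y n] y unfolding s_def by simp
  have s0: "0 < s m" if "m > 0" for m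
    unfolding s_def using x that by (intro sum_pos) auto
  have "real n * real (Suc n) * x ^ n \<le> real n * real (Suc n) * (y ^ k * y ^ n)"
  proof -
    have "x ^ n = y ^ (2 * n)" by (simp add: y power_mult)
    also have "\<dots> \<le> y ^ (k + n)" using y k by (intro power_decreasing) auto
    finally show ?thesis by (intro mult_left_mono) (auto simp: power_add)
  qed
  also have "\<dots> = (real n * y ^ k) * (real (Suc n) * y ^ n)" by simp
  also have "\<dots> \<le> s n * s (Suc n)"
    using s1 s2 y s0[of n] n by (intro mult_mono) auto
  finally have key: "real n * real (Suc n) * x ^ n \<le> s n * s (Suc n)" .
  have "s (Suc n) = 1 + x * s n"
    unfolding s_def by (simp add: sum.lessThan_Suc_shift sum_distrib_left del: sum.lessThan_Suc)
  hence "x ^ n / s n - x ^ Suc n / s (Suc n) = x ^ n / (s n * s (Suc n))"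
    using s0[of n] s0[of "Suc n"] n by (simp add: field_simps)
  also have "\<dots> \<le> 1 / (real n * real (Suc n))"
    using key s0[of n] s0[of "Suc n"] n by (simp add: field_simps del: of_nat_Suc)
  also have "\<dots> = 1 / real n - 1 / real (Suc n)"
    using n by (simp add: field_simps)
  finally have "1 / real (Suc n) - x ^ Suc n / s (Suc n) \<le> 1 / real n - x ^ n / s n" by simp
  thus ?thesis
    using x n by (simp add: monsky_eq divide_right_mono s_def del: sum.lessThan_Suc power_Suc of_nat_Suc)
qed

lemma monsky_nonneg:
  assumes x: "0 < x" "x < 1" and n: "n > 0"
  shows "0 \<le> monsky x n"
proof -
  have "real n * x ^ n = (\<Sum>i<n. x ^ n)" by simp
  also have "\<dots> \<le> (\<Sum>i<n. x ^ i)" using x by (intro sum_mono power_decreasing) auto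
  finally have "real n * x ^ n \<le> (\<Sum>i<n. x ^ i)" .
  moreover have "0 < (\<Sum>i<n. x ^ i)" using x n by (intro sum_pos) auto
  ultimately show ?thesis
    using x n by (simp add: monsky_eq field_simps)
qed

text \<open>The geometric series for x^d/(1 - x^d) is cut at dk <= N, so its tail starts beyond
  exponent N; bounding 1 - x^d below by 1 - x makes the error uniform in d. With this cut all double
  sums stay finite.\<close>

lemma lambert_truncation:
  fixes x :: real
  assumes x: "0 < x" "x < 1" and d: "1 \<le> d" "d \<le> N"
  shows "\<bar>x ^ d / (1 - x ^ d) - (\<Sum>k=1..N div d. x ^ (d * k))\<bar> \<le> x ^ N / (1 - x)"
proof -
  define K where "K = N div d"
  have xd: "x ^ d \<le> x" "x ^ d < 1" "0 < x ^ d"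
    using x d power_decreasing[of 1 d x] by (auto simp: power_less_one_iff)
  have "(1 - x ^ d) * (\<Sum>k=1..K. x ^ (d * k)) = x ^ d - x ^ (d * Suc K)"
  proof (induction K)
    case (Suc K)
    have "(1 - x ^ d) * (\<Sum>k=1..Suc K. x ^ (d * k)) =
        (1 - x ^ d) * (\<Sum>k=1..K. x ^ (d * k)) + (1 - x ^ d) * x ^ (d * Suc K)"
      by (simp add: distrib_left)
    also have "\<dots> = x ^ d - x ^ (d * Suc (Suc K))"
      unfolding Suc by (simp add: algebra_simps power_add)
    finally show ?case .
  qed simp
  hence "x ^ d / (1 - x ^ d) - (\<Sum>k=1..K. x ^ (d * k)) = x ^ (d * Suc K) / (1 - x ^ d)"
    using xd by (simp add: field_simps)
  moreover have "x ^ (d * Suc K) \<le> x ^ N"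
    using x d dividend_less_times_div[of d N] unfolding K_def by (intro power_decreasing) auto
  hence "x ^ (d * Suc K) / (1 - x ^ d) \<le> x ^ N / (1 - x)"
    using x xd by (intro frac_le) auto
  moreover have "0 \<le> x ^ (d * Suc K) / (1 - x ^ d)" using xd x by auto
  ultimately show ?thesis unfolding K_def by linarith
qed

context real_character
begin

text \<open>The sum of \<open>conv_one n\<close> x^n over n <= N is regrouped by n = dk, and only
  its square n are kept for the lower bound. The truncation costs N x^N/(1 - x), which tends to 0
  for fixed x.\<close>

lemma sum_squares_le_lambert:
  assumes x: "0 < x" "x < 1"
  shows "(\<Sum>r | 0 < r \<and> r\<^sup>2 \<le> N. x ^ r\<^sup>2) - real N * (x ^ N / (1 - x)) \<le> (\<Sum>d=1..N. \<chi> d * (x ^ d / (1 - x ^ d)))"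
proof -
  have "{r. 0 < r \<and> r\<^sup>2 \<le> N} \<subseteq> {..N}"
    by (auto intro: power2_nat_le_imp_le)
  hence fin: "finite {r. 0 < r \<and> r\<^sup>2 \<le> N}" using finite_subset by blast
  have "(\<Sum>r | 0 < r \<and> r\<^sup>2 \<le> N. x ^ r\<^sup>2) \<le> (\<Sum>r | 0 < r \<and> r\<^sup>2 \<le> N. conv_one (r\<^sup>2) * x ^ r\<^sup>2)"
    using x conv_one_square_ge_1 by (intro sum_mono) (auto simp: mult_le_cancel_right1)
  also have "\<dots> = (\<Sum>n\<in>(\<lambda>r. r\<^sup>2) ` {r. 0 < r \<and> r\<^sup>2 \<le> N}. conv_one n * x ^ n)"
    by (subst sum.reindex) (auto simp: inj_on_def)
  also have "\<dots> \<le> (\<Sum>n=1..N. conv_one n * x ^ n)"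
    using x conv_one_nonneg by (intro sum_mono2) auto
  also have "\<dots> = (\<Sum>n=1..N. \<Sum>d | d dvd n. \<chi> d * x ^ (d * (n div d)))"
    unfolding conv_one_def sum_distrib_right by (intro sum.cong) auto
  also have "\<dots> = (\<Sum>d=1..N. \<Sum>k=1..N div d. \<chi> d * x ^ (d * k))"
    by (rule sum_divisors_swap)
  also have "\<dots> = (\<Sum>d=1..N. \<chi> d * (x ^ d / (1 - x ^ d)))
      - (\<Sum>d=1..N. \<chi> d * (x ^ d / (1 - x ^ d) - (\<Sum>k=1..N div d. x ^ (d * k))))"
    by (simp add: sum_subtractf[symmetric] sum_distrib_left algebra_simps)
  also have "\<dots> \<le> (\<Sum>d=1..N. \<chi> d * (x ^ d / (1 - x ^ d))) + (\<Sum>d=1..N. 1 * (x ^ N / (1 - x)))"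
  proof -
    have "\<bar>\<Sum>d=1..N. \<chi> d * (x ^ d / (1 - x ^ d) - (\<Sum>k=1..N div d. x ^ (d * k)))\<bar> \<le> (\<Sum>d=1..N. 1 * (x ^ N / (1 - x)))"
      unfolding abs_mult using abs_le_1 lambert_truncation[OF x]
      by (intro sum_abs[THEN order_trans] sum_mono) (unfold abs_mult, intro mult_mono, auto)
    thus ?thesis by linarith
  qed
  finally show ?thesis by simp
qed

text \<open>Split x^d/(1 - x^d) = 1/(d(1 - x)) - \<open>monsky x d\<close>. The first part
  contributes O(1/N) because L1 = 0; Abel summation bounds the second by 2M times the first weight,
  which is 1 for every x. As N grows, the bound therefore loses its dependence on x.\<close>

lemma lambert_le:
  assumes x: "0 < x" "x < 1" and "L1 = 0"
  shows "(\<Sum>d=1..N. \<chi> d * (x ^ d / (1 - x ^ d))) \<le> 2 * real M + 2 * real M / (real (Suc N) * (1 - x))"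
proof -
  have "\<bar>\<Sum>d=1..<Suc N. \<chi> d * monsky x d\<bar> \<le> 2 * real M * monsky x 1"
    by (rule abs_sum_weighted_le) (use x monsky_decreasing monsky_nonneg in auto)
  also have "monsky x 1 = 1"
    using x by (simp add: monsky_def diff_divide_distrib[symmetric])
  finally have 1: "\<bar>\<Sum>d=1..N. \<chi> d * monsky x d\<bar> \<le> 2 * real M"
    by (simp add: atLeastLessThanSuc_atLeastAtMost)
  have "\<bar>\<Sum>d=1..N. \<chi> d / real d\<bar> \<le> 2 * real M / real (Suc N)"
    using abs_partial_sum_minus_L1_le[of N] \<open>L1 = 0\<close> by simp
  hence "(\<Sum>d=1..N. \<chi> d / real d) / (1 - x) \<le> 2 * real M / real (Suc N) / (1 - x)"
    using x by (intro divide_right_mono) auto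
  moreover have "(\<Sum>d=1..N. \<chi> d * (x ^ d / (1 - x ^ d))) =
      (\<Sum>d=1..N. \<chi> d / real d) / (1 - x) - (\<Sum>d=1..N. \<chi> d * monsky x d)"
    unfolding monsky_def by (simp add: sum_divide_distrib sum_subtractf[symmetric] right_diff_distrib mult.commute)
  ultimately show ?thesis using 1 by (simp add: abs_le_iff)
qed

lemma L1_nonzero: "L1 \<noteq> 0"
proof
  assume L1: "L1 = 0"
  \<comment> \<open>The coefficients of the Lambert series are nonnegative, and at least 1 at squares.\<close>
  have bound: "(\<Sum>r=1..K. x ^ r\<^sup>2) \<le> 2 * real M" if x: "0 < x" "x < 1" for x K
  proof -
    let ?e = "\<lambda>N. 2 * real M + 2 * real M / (real (Suc N) * (1 - x)) + real N * (x ^ N / (1 - x))"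
    have le: "(\<Sum>r=1..K. x ^ r\<^sup>2) \<le> ?e N" if "N \<ge> K\<^sup>2" for N
    proof -
      have "{r. 0 < r \<and> r\<^sup>2 \<le> N} \<subseteq> {..N}"
        by (auto intro: power2_nat_le_imp_le)
      hence fin: "finite {r. 0 < r \<and> r\<^sup>2 \<le> N}" using finite_subset by blast
      have "(\<Sum>r=1..K. x ^ r\<^sup>2) \<le> (\<Sum>r | 0 < r \<and> r\<^sup>2 \<le> N. x ^ r\<^sup>2)"
        using that x fin by (intro sum_mono2) (auto intro: order_trans[OF power_mono])
      thus ?thesis
        using sum_squares_le_lambert[OF x, of N] lambert_le[OF x L1, of N] by linarith
    qed
    have lim: "?e \<longlonglongrightarrow> 2 * real M + 0 + 0"
    proof (intro tendsto_add tendsto_const)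
      have "(\<lambda>N. 2 * real M / (1 - x) * (1 / real (Suc N))) \<longlonglongrightarrow> 2 * real M / (1 - x) * 0"
        by (intro tendsto_mult tendsto_const LIMSEQ_Suc lim_1_over_n)
      thus "(\<lambda>N. 2 * real M / (real (Suc N) * (1 - x))) \<longlonglongrightarrow> 0"
        by (simp add: mult.commute)
      have "(\<lambda>N. real N * x ^ N / (1 - x)) \<longlonglongrightarrow> 0 / (1 - x)"
        using x by (intro tendsto_divide tendsto_const powser_times_n_limit_0) auto
      thus "(\<lambda>N. real N * (x ^ N / (1 - x))) \<longlonglongrightarrow> 0" by simp
    qed
    have "(\<Sum>r=1..K. x ^ r\<^sup>2) \<le> 2 * real M + 0 + 0"
      by (rule LIMSEQ_le_const[OF lim]) (use le in blast)
    thus ?thesis by simp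
  qed
  \<comment> \<open>The bound 2M depends neither on x nor on K, so letting x tend to 1 with 2M + 1
    terms gives 2M + 1 <= 2M.\<close>
  define K where "K = Suc (2 * M)"
  have "((\<lambda>x. \<Sum>r=1..K. x ^ r\<^sup>2) \<longlongrightarrow> (\<Sum>r=1..K. 1 ^ r\<^sup>2)) (at_left (1::real))"
    by (intro tendsto_intros)
  moreover have "eventually (\<lambda>x. (\<Sum>r=1..K. x ^ r\<^sup>2) \<le> 2 * real M) (at_left 1)"
    using bound unfolding eventually_at_left_field by (intro exI[of _ 0]) auto
  ultimately have "(\<Sum>r=1..K. 1 ^ r\<^sup>2) \<le> 2 * real M"
    by (intro tendsto_upperbound) auto
  thus False by (simp add: K_def)
qed

section \<open>Mertens' estimate for the sums of chi(n) mangoldt(n)/n\<close>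

lemma ln_over_n_decreasing:
  assumes "3 \<le> n"
  shows "ln (real (Suc n)) / real (Suc n) \<le> ln (real n) / real n"
proof -
  have "exp 1 \<le> real n" using assms exp_le by linarith
  hence ln1: "1 \<le> ln (real n)" using assms by (subst ln_ge_iff) auto
  have "ln (real (Suc n)) - ln (real n) = ln (1 + 1 / real n)"
    using assms by (subst ln_divide_pos[symmetric]) (auto simp: add_divide_distrib add.commute)
  also have "\<dots> \<le> 1 / real n" by (rule ln_add_one_self_le_self) simp
  finally have "real n * (ln (real (Suc n)) - ln (real n)) \<le> 1"
    using assms by (simp add: field_simps)
  hence "real n * ln (real (Suc n)) \<le> real (Suc n) * ln (real n)"
    using ln1 by (simp add: algebra_simps)
  thus ?thesis using assms by (simp add: field_simps)
qed

text \<open>Since ln x / x decreases only beyond e, partial summation starts at n = 3; the term for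
  n = 1 is 0 and the one for n = 2 is estimated directly.\<close>

lemma abs_sum_ln_over_n_le: "\<bar>\<Sum>n=1..N. \<chi> n * (ln (real n) / real n)\<bar> \<le> 1 + 2 * real M * ln 3"
proof (cases "N \<ge> 3")
  case True
  have "(\<Sum>n=1..N. \<chi> n * (ln (real n) / real n)) =
      \<chi> 2 * (ln 2 / 2) + (\<Sum>n=3..<Suc N. \<chi> n * (ln (real n) / real n))"
    using True by (induction N rule: dec_induct) (auto simp: eval_nat_numeral)
  moreover have "\<bar>\<chi> 2 * (ln 2 / 2)\<bar> \<le> 1 * 1"
    unfolding abs_mult using abs_le_1[of 2] ln_2_less_1 by (intro mult_mono) auto
  moreover have "\<bar>\<Sum>n=3..<Suc N. \<chi> n * (ln (real n) / real n)\<bar> \<le> 2 * real M * (ln (real 3) / real 3)"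
    by (rule abs_sum_weighted_le) (use ln_over_n_decreasing in auto)
  moreover have "2 * real M * (ln (real 3) / real 3) \<le> 2 * real M * ln 3"
    by (intro mult_left_mono) auto
  ultimately show ?thesis by linarith
next
  case False
  then consider "N = 0" | "N = 1" | "N = 2" by linarith
  moreover have "\<bar>\<chi> 2 * (ln 2 / 2)\<bar> \<le> 1 * 1"
    unfolding abs_mult using abs_le_1[of 2] ln_2_less_1 by (intro mult_mono) auto
  moreover have "0 \<le> 2 * real M * ln 3" by auto
  moreover have "(\<Sum>n=1..2. \<chi> n * (ln (real n) / real n)) = \<chi> 2 * (ln 2 / 2)"
    by (simp add: numeral_2_eq_2)
  ultimately show ?thesis
  proof cases
    case 3
    thus ?thesis
      using \<open>\<bar>\<chi> 2 * (ln 2 / 2)\<bar> \<le> 1 * 1\<close> \<open>0 \<le> 2 * real M * ln 3\<close>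
        \<open>(\<Sum>n=1..2. \<chi> n * (ln (real n) / real n)) = \<chi> 2 * (ln 2 / 2)\<close> by (simp only:)
  qed auto
qed

text \<open>Expand ln n as the sum of mangoldt(d) over d | n inside the bounded sum of chi(n) ln n /
  n. By multiplicativity the inner sum over k <= N/d is \<open>L1 + R (N div d)\<close>, with the
  second term at most 2M d/N in absolute value, so the errors add up to at most (2M/N) psi(N) <=
  12M. What remains is L1 times the sum in question, and L1 is nonzero.\<close>

lemma sum_mangoldt_bounded: "\<exists>C. \<forall>N. \<bar>\<Sum>n=1..N. \<chi> n * (mangoldt n / real n)\<bar> \<le> C"
proof -
  have "\<bar>L1\<bar> * \<bar>\<Sum>n=1..N. \<chi> n * (mangoldt n / real n)\<bar> \<le> 1 + 2 * real M * ln 3 + 12 * real M" for N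
  proof (cases "N = 0")
    case True
    then show ?thesis by simp
  next
    case False
    define R where "R K = (\<Sum>k=1..K. \<chi> k / real k) - L1" for K
    have "(\<Sum>n=1..N. \<chi> n * (ln (real n) / real n)) =
        (\<Sum>n=1..N. \<Sum>d | d dvd n. \<chi> d * (mangoldt d / real d) * (\<chi> (n div d) / real (n div d)))"
    proof (rule sum.cong[OF refl])
      fix n assume n: "n \<in> {1..N}"
      have "(\<Sum>d | d dvd n. \<chi> d * (mangoldt d / real d) * (\<chi> (n div d) / real (n div d))) =
          (\<Sum>d | d dvd n. \<chi> n / real n * mangoldt d)"
      proof (rule sum.cong[OF refl])
        fix d assume "d \<in> {d. d dvd n}"
        then obtain k where k: "n = d * k" by blast
        hence "d > 0" using n by (auto intro: Nat.gr0I)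
        hence "n div d = k" using k by simp
        thus "\<chi> d * (mangoldt d / real d) * (\<chi> (n div d) / real (n div d)) = \<chi> n / real n * mangoldt d"
          by (simp add: k mult)
      qed
      also have "\<dots> = \<chi> n / real n * ln (real n)"
        using n by (simp add: sum_distrib_left[symmetric] sum_divide_distrib[symmetric] mangoldt_sum)
      finally show "\<chi> n * (ln (real n) / real n) =
          (\<Sum>d | d dvd n. \<chi> d * (mangoldt d / real d) * (\<chi> (n div d) / real (n div d)))" by simp
    qed
    also have "\<dots> = (\<Sum>d=1..N. \<Sum>k=1..N div d. \<chi> d * (mangoldt d / real d) * (\<chi> k / real k))"
      by (rule sum_divisors_swap)
    also have "\<dots> = (\<Sum>d=1..N. \<chi> d * (mangoldt d / real d) * (L1 + R (N div d)))"
      unfolding R_def by (simp only: sum_distrib_left[symmetric] diff_add_cancel add_diff_cancel_left' add_diff_eq)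
    also have "\<dots> = L1 * (\<Sum>n=1..N. \<chi> n * (mangoldt n / real n)) +
        (\<Sum>d=1..N. \<chi> d * (mangoldt d / real d) * R (N div d))"
      by (simp add: sum_distrib_left sum.distrib[symmetric] algebra_simps add_divide_distrib)
    finally have eq: "(\<Sum>n=1..N. \<chi> n * (ln (real n) / real n)) =
        L1 * (\<Sum>n=1..N. \<chi> n * (mangoldt n / real n)) +
        (\<Sum>d=1..N. \<chi> d * (mangoldt d / real d) * R (N div d))" .
    have "\<bar>\<Sum>d=1..N. \<chi> d * (mangoldt d / real d) * R (N div d)\<bar> \<le> (\<Sum>d=1..N. 2 * real M / real N * mangoldt d)"
    proof (intro sum_abs[THEN order_trans] sum_mono)
      fix d assume d: "d \<in> {1..N}"
      have "real N < real d * real (Suc (N div d))"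
        using dividend_less_times_div[of d N] d by (simp flip: of_nat_mult del: of_nat_Suc)
      hence "2 * real M / real (Suc (N div d)) \<le> 2 * real M * real d / real N"
        using d False by (simp add: field_simps mult_left_mono del: of_nat_Suc)
      hence "\<bar>R (N div d)\<bar> \<le> 2 * real M * real d / real N"
        using abs_partial_sum_minus_L1_le[of "N div d"] by (simp add: R_def)
      hence "\<bar>\<chi> d\<bar> * (mangoldt d / real d) * \<bar>R (N div d)\<bar> \<le> 1 * (mangoldt d / real d) * (2 * real M * real d / real N)"
        using abs_le_1 mangoldt_nonneg by (intro mult_mono) (auto intro!: divide_nonneg_nonneg)
      thus "\<bar>\<chi> d * (mangoldt d / real d) * R (N div d)\<bar> \<le> 2 * real M / real N * mangoldt d"
        using d by (simp add: abs_mult mult_ac)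
    qed
    also have "\<dots> = 2 * real M / real N * (\<Sum>d=1..N. mangoldt d)"
      by (simp add: sum_distrib_left)
    also have "\<dots> \<le> 2 * real M / real N * (6 * real N)"
      by (intro mult_left_mono psi_le) auto
    also have "\<dots> = 12 * real M" using False by simp
    finally have "\<bar>L1 * (\<Sum>n=1..N. \<chi> n * (mangoldt n / real n))\<bar> \<le> 1 + 2 * real M * ln 3 + 12 * real M"
      using eq abs_sum_ln_over_n_le[of N] by linarith
    thus ?thesis by (simp add: abs_mult)
  qed
  hence "\<bar>\<Sum>n=1..N. \<chi> n * (mangoldt n / real n)\<bar> \<le> (1 + 2 * real M * ln 3 + 12 * real M) / \<bar>L1\<bar>" for N
    using L1_nonzero by (simp add: field_simps)
  thus ?thesis by blast
qed

end

section \<open>From bounded character sums to a prime with given signs\<close>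

lemma real_character_prod:
  assumes "finite S" "0 < (M::nat)"
    and one: "\<And>i. i \<in> S \<Longrightarrow> \<chi> i (Suc 0) = (1::real)"
    and mult: "\<And>i a b. i \<in> S \<Longrightarrow> \<chi> i (a * b) = \<chi> i a * \<chi> i b"
    and vals: "\<And>i a. i \<in> S \<Longrightarrow> \<chi> i a \<in> {-1, 0, 1}"
    and periodic: "\<And>i a. i \<in> S \<Longrightarrow> \<chi> i (a mod M) = \<chi> i a"
    and g: "coprime g M" "(\<Prod>i\<in>S. \<chi> i g) = -1"
  shows "real_character (\<lambda>n. \<Prod>i\<in>S. \<chi> i n) M"
proof
  let ?P = "\<lambda>n. \<Prod>i\<in>S. \<chi> i n"
  show "0 < M" by fact
  show "?P (Suc 0) = 1" by (simp add: one)
  show mult': "?P (a * b) = ?P a * ?P b" for a b by (simp add: mult prod.distrib)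
  show "?P a \<in> {-1, 0, 1}" for a
    using \<open>finite S\<close> vals
  proof (induction S rule: finite_induct)
    case (insert x F)
    have "\<chi> x a \<in> {-1, 0, 1}" using insert.prems by blast
    moreover have "(\<Prod>i\<in>F. \<chi> i a) \<in> {-1, 0, 1}" using insert by blast
    ultimately show ?case using insert.hyps by auto
  qed simp
  have periodic': "?P (a mod M) = ?P a" for a
    by (intro prod.cong) (simp_all add: periodic)
  show "?P (a + M) = ?P a" for a
    using periodic'[of "a + M"] periodic'[of a] by simp
  \<comment> \<open>Multiplication by g permutes the residues and flips the sign of the sum.\<close>
  have inj: "inj_on (\<lambda>n. g * n mod M) {..<M}"
  proof (rule inj_onI)
    fix a b assume "a \<in> {..<M}" "b \<in> {..<M}" "g * a mod M = g * b mod M"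
    thus "a = b" using g(1) cong_mult_lcancel_nat[of g M a b] by (simp add: cong_def)
  qed
  moreover have "(\<lambda>n. g * n mod M) ` {..<M} \<subseteq> {..<M}" using \<open>0 < M\<close> by auto
  ultimately have "(\<lambda>n. g * n mod M) ` {..<M} = {..<M}" by (intro endo_inj_surj) auto
  hence "(\<Sum>n<M. ?P n) = (\<Sum>n\<in>(\<lambda>n. g * n mod M) ` {..<M}. ?P n)" by simp
  also have "\<dots> = (\<Sum>n<M. ?P (g * n))"
    using inj by (subst sum.reindex) (simp_all add: periodic')
  also have "\<dots> = - (\<Sum>n<M. ?P n)"
    by (simp add: mult' g sum_negf)
  finally show "(\<Sum>n<M. ?P n) = 0" by linarith
qed

lemma sum_ln_over_square_bounded:
  assumes "0 < m"
  shows "\<exists>C. \<forall>N. (\<Sum>r=1..N. ln (real m * (real r)\<^sup>2) / (real r)\<^sup>2) \<le> C"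
proof -
  define A where "A = ln (real m)"
  have A: "0 \<le> A" using assms by (auto simp: A_def)
  \<comment> \<open>H is a telescoping majorant, modelled on the integral of ln(m x^2) / x^2.\<close>
  define H where "H r = (A + 2 * ln (real r) + 4) / real r" for r
  have ln_eq: "ln (real m * (real r)\<^sup>2) = A + 2 * ln (real r)" if "r > 0" for r
    using that assms by (simp add: A_def ln_mult ln_realpow)
  have step: "(A + 2 * ln (real (Suc r))) / (real (Suc r))\<^sup>2 \<le> H r - H (Suc r)" if r: "r > 0" for r
  proof -
    define x where "x = real r"
    define l where "l = ln (x + 1)"
    have x: "1 \<le> x" using r by (simp add: x_def)
    have l: "0 \<le> l" using x by (simp add: l_def)
    have "l - ln x = ln (1 + 1 / x)"
      using x unfolding l_def by (subst ln_divide_pos[symmetric]) (auto simp: add_divide_distrib add.commute)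
    also have "\<dots> \<le> 1 / x" using x by (intro ln_add_one_self_le_self) simp
    finally have "(A + 2 * (l - 1 / x) + 4) / x \<le> (A + 2 * ln x + 4) / x"
      using x by (intro divide_right_mono) auto
    moreover have "(A + 2 * (l - 1 / x) + 4) / x - (A + 2 * l + 4) / (x + 1) =
        (A + 2 * l) / (x * (x + 1)) + (4 / (x * (x + 1)) - 2 / x\<^sup>2)"
    proof -
      have "(A + 2 * (l - 1 / x) + 4) / x = (A + 2 * l + 4) / x - 2 / x\<^sup>2"
        by (simp add: add_divide_distrib diff_divide_distrib power2_eq_square)
      moreover have "(A + 2 * l + 4) / x - (A + 2 * l + 4) / (x + 1) = (A + 2 * l + 4) / (x * (x + 1))"
        using x by (subst diff_frac_eq) (auto simp: algebra_simps)
      ultimately show ?thesis by (simp add: add_divide_distrib)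
    qed
    \<comment> \<open>The constant 4 in \<open>H\<close> pays for the loss 2/x^2 caused by replacing
      ln x with l - 1/x; this uses x + 1 <= 2x.\<close>
    moreover have "2 / x\<^sup>2 \<le> 4 / (x * (x + 1))"
    proof -
      have "2 / x\<^sup>2 = 4 / (x * (2 * x))" by (simp add: power2_eq_square)
      also have "\<dots> \<le> 4 / (x * (x + 1))" using x by (intro divide_left_mono mult_left_mono) auto
      finally show ?thesis .
    qed
    moreover have "(A + 2 * l) / (x + 1)\<^sup>2 \<le> (A + 2 * l) / (x * (x + 1))"
      using x A l by (intro divide_left_mono) (auto simp: power2_eq_square)
    ultimately have "(A + 2 * l) / (x + 1)\<^sup>2 \<le> (A + 2 * ln x + 4) / x - (A + 2 * l + 4) / (x + 1)"
      by linarith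
    thus ?thesis by (simp add: H_def l_def x_def add.commute)
  qed
  have tele: "(\<Sum>r=1..Suc N. ln (real m * (real r)\<^sup>2) / (real r)\<^sup>2) \<le> 2 * A + 4 - H (Suc N)" for N
  proof (induction N)
    case 0
    show ?case using ln_eq[of 1] by (simp add: H_def)
  next
    case (Suc N)
    have "(\<Sum>r=1..Suc (Suc N). ln (real m * (real r)\<^sup>2) / (real r)\<^sup>2) =
        (\<Sum>r=1..Suc N. ln (real m * (real r)\<^sup>2) / (real r)\<^sup>2) +
        (A + 2 * ln (real (Suc (Suc N)))) / (real (Suc (Suc N)))\<^sup>2"
      by (simp only: sum.atLeast_Suc_atMost_Suc_shift sum.cl_ivl_Suc ln_eq[of "Suc (Suc N)"]) simp
    thus ?case using Suc step[of "Suc N"] by linarith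
  qed
  have H: "0 \<le> H (Suc N)" for N using A by (simp add: H_def)
  have "(\<Sum>r=1..Suc N. ln (real m * (real r)\<^sup>2) / (real r)\<^sup>2) \<le> 2 * A + 4" for N
    using tele[of N] H[of N] by linarith
  hence "(\<Sum>r=1..N. ln (real m * (real r)\<^sup>2) / (real r)\<^sup>2) \<le> 2 * A + 4" for N
    using A by (cases N) auto
  thus ?thesis by blast
qed

text \<open>\<open>indep\<close> provides for each character an argument that negates it alone, so
  the product over any nonempty subset takes the value -1 and is nonprincipal. Hence all terms of
  the expanded weight but one have bounded sums.\<close>

theorem prime_with_prescribed_signs:
  fixes \<chi> :: "'i \<Rightarrow> nat \<Rightarrow> real" and \<epsilon> :: "'i \<Rightarrow> real"
  assumes "finite I" "0 < M"
    and one: "\<And>i. i \<in> I \<Longrightarrow> \<chi> i (Suc 0) = 1"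
    and mult: "\<And>i a b. i \<in> I \<Longrightarrow> \<chi> i (a * b) = \<chi> i a * \<chi> i b"
    and vals: "\<And>i a. i \<in> I \<Longrightarrow> \<chi> i a \<in> {-1, 0, 1}"
    and periodic: "\<And>i a. i \<in> I \<Longrightarrow> \<chi> i (a mod M) = \<chi> i a"
    and nonzero: "\<And>i a. i \<in> I \<Longrightarrow> coprime a M \<Longrightarrow> \<chi> i a \<noteq> 0"
    and indep: "\<And>i. i \<in> I \<Longrightarrow> \<exists>g. coprime g M \<and> \<chi> i g = -1 \<and> (\<forall>j\<in>I - {i}. \<chi> j g = 1)"
    and \<epsilon>: "\<And>i. i \<in> I \<Longrightarrow> \<epsilon> i \<in> {-1, 1}"
  shows "\<exists>q. prime q \<and> coprime q M \<and> (\<forall>i\<in>I. \<chi> i q = \<epsilon> i)"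
proof (rule ccontr)
  assume no: "\<not> ?thesis"
  \<comment> \<open>The weight w(n) vanishes if some sign at n is opposite to the prescribed one. The term 1 of its expanded
    product makes S unbounded; without such a prime, w(n) \<Lambda>(n) is supported on the m r^2 with m <= M.\<close>
  define w where "w n = (\<Prod>i\<in>I. \<epsilon> i * \<chi> i n + 1)" for n
  define S where "S N = (\<Sum>n=1..N. w n * (mangoldt n / real n))" for N
  have factor: "\<epsilon> i * \<chi> i n + 1 \<in> {0, 1, 2}" if "i \<in> I" for i n
    using vals[OF that, of n] \<epsilon>[OF that] by auto
  have w_bounds: "0 \<le> w n \<and> w n \<le> 2 ^ card I" for n
  proof
    have factor': "0 \<le> \<epsilon> i * \<chi> i n + 1 \<and> \<epsilon> i * \<chi> i n + 1 \<le> 2" if "i \<in> I" for i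
      using factor[OF that, of n] by auto
    thus "0 \<le> w n" unfolding w_def by (intro prod_nonneg) blast
    have "w n \<le> (\<Prod>i\<in>I. 2)" unfolding w_def using factor' by (intro prod_mono) blast
    thus "w n \<le> 2 ^ card I" by simp
  qed

  have support: "\<exists>m r. 0 < m \<and> m \<le> M \<and> 0 < r \<and> n = m * r\<^sup>2" if n: "n > 0" "w n \<noteq> 0" "mangoldt n \<noteq> (0::real)" for n
  proof -
    have "primepow n" using n(3) by (auto simp: mangoldt_def split: if_splits)
    then obtain p k where p: "prime p" "n = p ^ k" by (auto simp: primepow_def)
    have p0: "p > 0" using p prime_gt_0_nat by blast
    show ?thesis
    proof (cases "even k")
      case True
      then obtain j where "k = 2 * j" by blast
      hence "n = 1 * (p ^ j)\<^sup>2" using p by (simp add: power_mult mult.commute)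
      moreover have "0 < p ^ j" "1 \<le> M" using p0 \<open>0 < M\<close> by simp_all
      ultimately show ?thesis by (metis zero_less_one)
    next
      case False
      then obtain j where k: "k = 2 * j + 1" using oddE by blast
      \<comment> \<open>If p is coprime to M, all its signs are 1 or -1, and as k is odd they agree
        with the signs of p^k. A nonzero weight then makes every sign the prescribed one, so p would
        be the prime assumed not to exist.\<close>
      have "p dvd M"
      proof (rule ccontr)
        assume "\<not> p dvd M"
        hence cop: "coprime p M" using p prime_imp_coprime by blast
        have "\<chi> i p = \<epsilon> i" if i: "i \<in> I" for i
        proof -
          have pow: "\<chi> i (p ^ m) = \<chi> i p ^ m" for m
            using one[OF i] mult[OF i] by (induction m) auto
          have "\<chi> i p \<in> {-1, 1}" using vals[OF i, of p] nonzero[OF i cop] by auto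
          hence "\<chi> i p ^ k = \<chi> i p" by (auto simp: k)
          hence "\<chi> i n = \<chi> i p" by (simp add: p pow)
          moreover have "\<epsilon> i * \<chi> i n + 1 \<noteq> 0"
            using n(2) i \<open>finite I\<close> unfolding w_def by auto
          ultimately show ?thesis using \<open>\<chi> i p \<in> {-1, 1}\<close> \<epsilon>[OF i] by auto
        qed
        with no p cop show False by blast
      qed
      hence "p \<le> M" using \<open>0 < M\<close> by (simp add: dvd_imp_le)
      moreover have "n = p * (p ^ j)\<^sup>2" by (simp add: p k power_mult[of p j 2, symmetric] mult.commute)
      moreover have "0 < p ^ j" using p0 by simp
      ultimately show ?thesis using p0 by blast
    qed
  qed
  obtain C where C: "\<And>N. (\<Sum>r=1..N. ln (real M * (real r)\<^sup>2) / (real r)\<^sup>2) \<le> C"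
    using sum_ln_over_square_bounded[OF \<open>0 < M\<close>] by blast
  have upper: "S N \<le> 2 ^ card I * (real M * C)" for N
  proof -
    let ?h = "\<lambda>n. w n * (mangoldt n / real n)"
    have "S N = (\<Sum>n\<in>{n\<in>{1..N}. ?h n \<noteq> 0}. ?h n)"
      unfolding S_def by (rule sum.mono_neutral_right) auto
    also have "\<dots> \<le> (\<Sum>(m, r)\<in>{1..M} \<times> {1..N}. 2 ^ card I * (ln (real M * (real r)\<^sup>2) / (real r)\<^sup>2))"
    \<comment> \<open>It suffices that every n of the support is hit by some (m, r): the terms on
      the right are nonnegative, so counting an n several times is harmless.\<close>
    proof (rule sum_le_included[where i = "\<lambda>(m, r). m * r\<^sup>2"])
      show "\<forall>y\<in>{1..M} \<times> {1..N}. 0 \<le> (case y of (m, r) \<Rightarrow> 2 ^ card I * (ln (real M * (real r)\<^sup>2) / (real r)\<^sup>2))"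
      proof (clarify)
        fix m r assume "m \<in> {1..M}" "r \<in> {1..N}"
        hence "1 * 1 \<le> real M * (real r)\<^sup>2" by (intro mult_mono) auto
        thus "0 \<le> 2 ^ card I * (ln (real M * (real r)\<^sup>2) / (real r)\<^sup>2)" by simp
      qed
    next
      show "\<forall>n\<in>{n \<in> {1..N}. ?h n \<noteq> 0}. \<exists>y\<in>{1..M} \<times> {1..N}. (case y of (m, r) \<Rightarrow> m * r\<^sup>2) = n \<and>
          ?h n \<le> (case y of (m, r) \<Rightarrow> 2 ^ card I * (ln (real M * (real r)\<^sup>2) / (real r)\<^sup>2))"
      proof
        fix n assume n: "n \<in> {n \<in> {1..N}. ?h n \<noteq> 0}"
        then obtain m r where mr: "0 < m" "m \<le> M" "0 < r" "n = m * r\<^sup>2"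
          using support[of n] by auto
        have "r \<le> r\<^sup>2" "r\<^sup>2 \<le> n" using mr by (auto simp: power2_eq_square)
        hence "r \<le> N" using n by auto
        have "mangoldt n \<le> ln (real n)" using n by (intro mangoldt_le) auto
        also have "\<dots> \<le> ln (real M * (real r)\<^sup>2)"
          using mr by (subst ln_le_cancel_iff) auto
        finally have le: "mangoldt n \<le> ln (real M * (real r)\<^sup>2)" .
        have "1 * 1 \<le> real M * (real r)\<^sup>2"
          using mr \<open>0 < M\<close> by (intro mult_mono) auto
        hence "mangoldt n / real n \<le> ln (real M * (real r)\<^sup>2) / (real r)\<^sup>2"
          using mr le by (intro frac_le) auto
        hence "?h n \<le> 2 ^ card I * (ln (real M * (real r)\<^sup>2) / (real r)\<^sup>2)"
          using w_bounds mangoldt_nonneg[of n] by (intro mult_mono) auto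
        thus "\<exists>y\<in>{1..M} \<times> {1..N}. (case y of (m, r) \<Rightarrow> m * r\<^sup>2) = n \<and>
          ?h n \<le> (case y of (m, r) \<Rightarrow> 2 ^ card I * (ln (real M * (real r)\<^sup>2) / (real r)\<^sup>2))"
          using mr \<open>r \<le> N\<close> by (intro bexI[of _ "(m, r)"]) auto
      qed
    qed auto
    also have "\<dots> = 2 ^ card I * (real M * (\<Sum>r=1..N. ln (real M * (real r)\<^sup>2) / (real r)\<^sup>2))"
      by (simp add: sum.cartesian_product[symmetric] sum_distrib_left mult_ac)
    also have "\<dots> \<le> 2 ^ card I * (real M * C)"
      by (intro mult_left_mono C) auto
    finally show ?thesis .
  qed
  have bounded: "\<exists>C. \<forall>N. \<bar>\<Sum>n=1..N. (\<Prod>i\<in>X. \<epsilon> i * \<chi> i n) * (mangoldt n / real n)\<bar> \<le> C" if X: "X \<subseteq> I" "X \<noteq> {}" for X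
  proof -
    obtain i where i: "i \<in> X" using X by blast
    then obtain g where g: "coprime g M" "\<chi> i g = -1" "\<forall>j\<in>I - {i}. \<chi> j g = 1"
      using indep X by blast
    have fin: "finite X" using X \<open>finite I\<close> finite_subset by blast
    have "(\<Prod>j\<in>X. \<chi> j g) = \<chi> i g * (\<Prod>j\<in>X - {i}. \<chi> j g)"
      using fin i by (rule prod.remove)
    also have "(\<Prod>j\<in>X - {i}. \<chi> j g) = 1" using g X by (intro prod.neutral) auto
    finally have "(\<Prod>j\<in>X. \<chi> j g) = -1" using g by simp
    note prod_g = this
    have sub: "j \<in> I" if "j \<in> X" for j using X that by blast
    have "real_character (\<lambda>n. \<Prod>j\<in>X. \<chi> j n) M"
      by (rule real_character_prod[where g = g])
         (simp_all add: fin \<open>0 < M\<close> one mult periodic g prod_g sub vals[OF sub, simplified])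
    from real_character.sum_mangoldt_bounded[OF this]
    obtain C where C: "\<And>N. \<bar>\<Sum>n=1..N. (\<Prod>j\<in>X. \<chi> j n) * (mangoldt n / real n)\<bar> \<le> C"
      by auto
    have "\<bar>\<Prod>j\<in>X. \<epsilon> j\<bar> = 1"
      unfolding abs_prod using \<epsilon> X by (intro prod.neutral) fastforce
    moreover have "(\<Sum>n=1..N. (\<Prod>i\<in>X. \<epsilon> i * \<chi> i n) * (mangoldt n / real n)) =
        (\<Prod>j\<in>X. \<epsilon> j) * (\<Sum>n=1..N. (\<Prod>j\<in>X. \<chi> j n) * (mangoldt n / real n))" for N
      unfolding prod.distrib sum_distrib_left by (simp only: mult.assoc)
    ultimately have "\<bar>\<Sum>n=1..N. (\<Prod>i\<in>X. \<epsilon> i * \<chi> i n) * (mangoldt n / real n)\<bar> \<le> C" for N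
      using C[of N] by (simp only: abs_mult mult_1)
    thus ?thesis by blast
  qed
  define B where "B X = (SOME C. \<forall>N. \<bar>\<Sum>n=1..N. (\<Prod>i\<in>X. \<epsilon> i * \<chi> i n) * (mangoldt n / real n)\<bar> \<le> C)" for X
  have B: "\<bar>\<Sum>n=1..N. (\<Prod>i\<in>X. \<epsilon> i * \<chi> i n) * (mangoldt n / real n)\<bar> \<le> B X" if "X \<subseteq> I" "X \<noteq> {}" for X N
    unfolding B_def by (rule spec[OF someI_ex[OF bounded[OF that]]])
  have lower: "ln (real N) - 1 - (\<Sum>X\<in>Pow I - {{}}. B X) \<le> S N" if "N > 0" for N
  proof -
    have "S N = (\<Sum>X\<in>Pow I. \<Sum>n=1..N. (\<Prod>i\<in>X. \<epsilon> i * \<chi> i n) * (mangoldt n / real n))"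
      unfolding S_def w_def prod_add[OF \<open>finite I\<close>] sum_distrib_right
      by (subst sum.swap) simp
    also have "\<dots> = (\<Sum>n=1..N. mangoldt n / real n) +
        (\<Sum>X\<in>Pow I - {{}}. \<Sum>n=1..N. (\<Prod>i\<in>X. \<epsilon> i * \<chi> i n) * (mangoldt n / real n))"
      using \<open>finite I\<close> by (subst sum.remove[of _ "{}"]) auto
    also have "\<dots> \<ge> (ln (real N) - 1) + (\<Sum>X\<in>Pow I - {{}}. - B X)"
    proof (intro add_mono sum_mangoldt_over_n_ge sum_mono that)
      fix X assume "X \<in> Pow I - {{}}"
      thus "- B X \<le> (\<Sum>n=1..N. (\<Prod>i\<in>X. \<epsilon> i * \<chi> i n) * (mangoldt n / real n))"
        using B[of X N] by (simp only: abs_le_iff) auto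
    qed
    finally show ?thesis by (simp add: sum_negf)
  qed
  define D where "D = 2 ^ card I * (real M * C) + 1 + (\<Sum>X\<in>Pow I - {{}}. B X)"
  have "ln (real N) \<le> D" if "N > 0" for N
    using upper[of N] lower[OF that] unfolding D_def by linarith
  note le = this
  obtain N where N: "exp (D + 1) \<le> real N" using real_arch_simple by blast
  hence "0 < real N" using exp_gt_zero[of "D + 1"] by linarith
  moreover from this have "D + 1 \<le> ln (real N)" using N by (subst ln_ge_iff)
  ultimately show False using le[of N] by simp
qed

section \<open>Primes with prescribed Legendre symbols\<close>

lemma Legendre_vals: "Legendre a p \<in> {-1, 0, 1}"
  by (simp add: Legendre_def)

lemma Legendre_eq_0_iff: "Legendre a p = 0 \<longleftrightarrow> p dvd a"
  by (simp add: Legendre_def cong_0_iff)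

lemma Legendre_eq_pm1: "\<not> p dvd a \<Longrightarrow> Legendre a p \<in> {-1, 1}"
  by (auto simp: Legendre_def cong_0_iff)

lemma Legendre_self_mult: "\<not> p dvd a \<Longrightarrow> Legendre a p * Legendre a p = 1"
  by (simp add: Legendre_def cong_0_iff)

lemma Legendre_cong: "[a = b] (mod p) \<Longrightarrow> Legendre a p = Legendre b p"
  by (simp add: Legendre_def QuadRes_def cong_def)

text \<open>This turns Euler's criterion, a congruence mod p, into equalities between
  symbols.\<close>

lemma small_int_cong:
  fixes x y p :: int
  assumes "[x = y] (mod p)" "x \<in> {-1, 0, 1}" "y \<in> {-1, 0, 1}" "2 < p"
  shows "x = y"
proof (rule ccontr)
  assume "x \<noteq> y"
  have "p dvd x - y" using assms by (simp add: cong_iff_dvd_diff)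
  hence "\<bar>p\<bar> \<le> \<bar>x - y\<bar>" using \<open>x \<noteq> y\<close> by (intro dvd_imp_le_int) auto
  thus False using assms by auto
qed

lemma Legendre_mult:
  assumes "prime p" "2 < p"
  shows "Legendre (a * b) (int p) = Legendre a (int p) * Legendre b (int p)"
proof (rule small_int_cong[where p = "int p"])
  have "[Legendre (a * b) (int p) = (a * b) ^ ((p - 1) div 2)] (mod int p)"
    by (rule euler_criterion[OF assms])
  also have "(a * b) ^ ((p - 1) div 2) = a ^ ((p - 1) div 2) * b ^ ((p - 1) div 2)"
    by (rule power_mult_distrib)
  also have "[a ^ ((p - 1) div 2) * b ^ ((p - 1) div 2) = Legendre a (int p) * Legendre b (int p)] (mod int p)"
    by (intro cong_mult cong_sym[OF euler_criterion[OF assms]])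
  finally show "[Legendre (a * b) (int p) = Legendre a (int p) * Legendre b (int p)] (mod int p)" .
  show "Legendre a (int p) * Legendre b (int p) \<in> {-1, 0, 1}"
    using Legendre_vals[of a "int p"] Legendre_vals[of b "int p"] by auto
qed (use Legendre_vals assms in auto)

lemma Legendre_1: "prime p \<Longrightarrow> Legendre 1 (int p) = 1"
  unfolding Legendre_def QuadRes_def
  by (auto simp: cong_0_iff intro!: exI[of _ 1] dest: prime_gt_1_int)

lemma odd_iff_mod_4: "odd n \<longleftrightarrow> n mod 4 \<in> {1, 3}" for n :: nat
proof -
  have "n mod 4 \<in> {0, 1, 2, 3}" by auto
  moreover have "odd n \<longleftrightarrow> odd (n mod 4)" by (simp add: dvd_mod_iff)
  ultimately show ?thesis by (elim insertE emptyE) simp_all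
qed

lemma mod_8_cases: "n mod 8 \<in> {0, 1, 2, 3, 4, 5, 6, 7}" for n :: nat
  by auto

lemma odd_iff_mod_8: "odd n \<longleftrightarrow> n mod 8 \<in> {1, 3, 5, 7}" for n :: nat
proof -
  have "odd n \<longleftrightarrow> odd (n mod 8)" by (simp add: dvd_mod_iff)
  thus ?thesis using mod_8_cases[of n] by (elim insertE emptyE) simp_all
qed

lemma mod_8_residue:
  fixes n :: nat
  assumes "n mod 8 = r"
  shows "n mod 4 = r mod 4" "odd n \<longleftrightarrow> odd r"
  unfolding assms[symmetric] by (simp_all add: mod_mod_cancel dvd_mod_iff)

lemma even_half_pred_iff:
  fixes q :: nat
  assumes "odd q"
  shows "even ((q - 1) div 2) \<longleftrightarrow> q mod 4 = 1"
proof -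
  obtain k where q: "q = 2 * k + 1" using assms by (rule oddE)
  have "q mod 4 = 2 * (k mod 2) + 1" using mod_mult2_eq[of q 2 2] by (simp add: q)
  thus ?thesis by (simp add: q even_iff_mod_2_eq_zero)
qed

lemma Legendre_minus_1:
  assumes "prime p" "2 < p"
  shows "Legendre (-1) (int p) = (-1) ^ ((p - 1) div 2)"
  by (rule small_int_cong[OF euler_criterion[OF assms]])
     (use assms Legendre_vals in \<open>auto simp: minus_one_power_iff\<close>)

lemma Legendre_2:
  assumes "prime p" "2 < p"
  shows "Legendre 2 (int p) = (if p mod 8 \<in> {1, 7} then 1 else -1)"
proof -
  have p: "odd p" using assms prime_odd_nat by simp
  have "\<not> int p dvd 2" using zdvd_imp_le[of "int p" 2] assms by auto
  then interpret GAUSS p 2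
    using assms by unfold_locales (auto simp: cong_0_iff)
  define h where "h = (int p - 1) div 2"
  have h: "int p = 2 * h + 1" "0 < h" using p assms by (auto simp: h_def)
  \<comment> \<open>The doubles of x <= h stay below p, so the reduction mod p in \<open>C\<close>
    changes nothing; \<open>E\<close> collects the doubles above h, that is, those with x > h div
    2.\<close>
  have "C = (\<lambda>x. x * 2) ` {0<..h}"
    unfolding C_def B_def A_def image_image h_def[symmetric]
    by (intro image_cong) (auto simp: h)
  hence "E = (\<lambda>x. x * 2) ` {h div 2<..h}"
    unfolding E_def h_def[symmetric] using h by auto
  hence "card E = card {h div 2<..h}"
    by (simp add: card_image inj_on_def)
  hence "card E = nat (h - h div 2)" by simp
  hence "Legendre 2 p = (-1) ^ nat (h - h div 2)"
    using gauss_lemma by simp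
  also have "\<dots> = (if p mod 8 \<in> {1, 7} then 1 else -1)"
  proof -
    define k where "k = int (p div 8)"
    have "p = 8 * (p div 8) + p mod 8" by simp
    hence "int p = 8 * k + int (p mod 8)" unfolding k_def by (metis of_nat_add of_nat_mult of_nat_numeral)
    moreover have "p mod 8 = 1 \<or> p mod 8 = 3 \<or> p mod 8 = 5 \<or> p mod 8 = 7" using p by (simp add: odd_iff_mod_8)
    ultimately consider "p mod 8 = 1" "h = 4 * k" | "p mod 8 = 3" "h = 4 * k + 1"
      | "p mod 8 = 5" "h = 4 * k + 2" | "p mod 8 = 7" "h = 4 * k + 3"
      using h(1) by (elim disjE) (simp_all add: algebra_simps)
    hence "even (h - h div 2) \<longleftrightarrow> p mod 8 \<in> {1, 7}"
    proof cases
      case 1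
      moreover have "even (4 * k - 4 * k div 2)" by presburger
      ultimately show ?thesis by simp
    next
      case 2
      moreover have "odd (4 * k + 1 - (4 * k + 1) div 2)" by presburger
      ultimately show ?thesis by simp
    next
      case 3
      moreover have "odd (4 * k + 2 - (4 * k + 2) div 2)" by presburger
      ultimately show ?thesis by simp
    next
      case 4
      moreover have "even (4 * k + 3 - (4 * k + 3) div 2)" by presburger
      ultimately show ?thesis by simp
    qed
    moreover have "even (nat (h - h div 2)) \<longleftrightarrow> even (h - h div 2)" using h by (simp add: even_nat_iff)
    ultimately show ?thesis by (simp add: minus_one_power_iff)
  qed
  finally show ?thesis .
qed

text \<open>Reciprocity with its sign expressed through q mod 4 and (-1/p): in the applications q
  mod 8 is prescribed, while p runs over arbitrary factors of m.\<close>

lemma Legendre_swap: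
  assumes "prime p" "2 < p" "prime q" "2 < q" "p \<noteq> q"
  shows "Legendre (int p) (int q) =
    (if q mod 4 = 1 then 1 else Legendre (-1) (int p)) * Legendre (int q) (int p)"
proof -
  have qr: "Legendre (int p) (int q) * Legendre (int q) (int p) = (-1) ^ ((p - 1) div 2 * ((q - 1) div 2))"
    using assms by (intro Quadratic_Reciprocity) auto
  have "\<not> int p dvd int q" using assms primes_dvd_imp_eq[of p q] by auto
  hence sq: "Legendre (int q) (int p) * Legendre (int q) (int p) = 1"
    by (rule Legendre_self_mult)
  have "odd q" using assms prime_odd_nat by simp
  hence "even ((q - 1) div 2) \<longleftrightarrow> q mod 4 = 1" by (rule even_half_pred_iff)
  hence "(-1::int) ^ ((p - 1) div 2 * ((q - 1) div 2)) = (if q mod 4 = 1 then 1 else Legendre (-1) (int p))"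
    using assms by (auto simp: Legendre_minus_1 power_mult mult.commute[of "(p - 1) div 2"] minus_one_power_iff)
  with qr have "Legendre (int p) (int q) * (Legendre (int q) (int p) * Legendre (int q) (int p)) =
      (if q mod 4 = 1 then 1 else Legendre (-1) (int p)) * Legendre (int q) (int p)"
    by (simp only: mult.assoc[symmetric])
  thus ?thesis by (simp only: sq mult_1_right)
qed

lemma Legendre_minus_3:
  assumes "prime q" "3 < q"
  shows "Legendre (-3) (int q) = Legendre (int q) 3"
proof -
  have "\<not> int q dvd -1" using assms by auto
  hence sq: "Legendre (-1) (int q) * Legendre (-1) (int q) = 1"
    by (rule Legendre_self_mult)
  have "Legendre (int q) (int 3) = (if 3 mod 4 = (1::nat) then 1 else Legendre (-1) (int q)) * Legendre (int 3) (int q)"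
    using assms by (intro Legendre_swap) auto
  moreover have "Legendre (-1 * 3) (int q) = Legendre (-1) (int q) * Legendre 3 (int q)"
    using assms by (intro Legendre_mult) auto
  ultimately show ?thesis by simp
qed

lemma Legendre_prod:
  assumes "prime q" "2 < q" "finite S"
  shows "Legendre (int (\<Prod>S)) (int q) = (\<Prod>p\<in>S. Legendre (int p) (int q))"
  using assms(3) by (induction S rule: finite_induct) (simp_all add: Legendre_1 Legendre_mult assms)

text \<open>Otherwise squaring would be surjective on the residues mod p, hence injective, although
  1 and p - 1 have the same square.\<close>

lemma exists_nonresidue:
  assumes "prime p" "2 < p"
  shows "\<exists>g. Legendre (int g) (int p) = -1"
proof (rule ccontr)
  assume no: "\<not> ?thesis"
  define sq where "sq = (\<lambda>y. nat (int y ^ 2 mod int p))"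
  have p0: "0 < p" using assms by simp
  have "{..<p} \<subseteq> sq ` {..<p}"
  proof
    fix g assume g: "g \<in> {..<p}"
    hence "Legendre (int g) (int p) \<in> {0, 1}" using no Legendre_vals[of "int g" "int p"] by auto
    hence "[int g = 0] (mod int p) \<or> (\<exists>y. [y ^ 2 = int g] (mod int p))"
      unfolding Legendre_def QuadRes_def by (auto split: if_splits)
    moreover have "[0 ^ 2 = int g] (mod int p)" if "[int g = 0] (mod int p)"
      using that by (simp add: cong_def)
    ultimately obtain y where y: "[y ^ 2 = int g] (mod int p)" by blast
    define z where "z = nat (y mod int p)"
    have z: "int z = y mod int p" "z < p" using p0 by (simp_all add: z_def nat_less_iff)
    have "int z ^ 2 mod int p = int g" unfolding z(1) power_mod using y g by (simp add: cong_def)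
    hence "sq z = g" unfolding sq_def by simp
    thus "g \<in> sq ` {..<p}" using z by blast
  qed
  hence "card {..<p} \<le> card (sq ` {..<p})" by (intro card_mono) auto
  hence "inj_on sq {..<p}" using card_image_le[of "{..<p}" sq] by (intro eq_card_imp_inj_on) auto
  moreover have "sq 1 = sq (p - 1)"
  proof -
    have "int (p - 1) ^ 2 = 1 + int p * (int p - 2)"
      using p0 by (simp add: of_nat_diff power2_eq_square algebra_simps)
    thus ?thesis by (simp add: sq_def)
  qed
  ultimately have "1 = p - 1" using assms by (auto dest!: inj_onD)
  thus False using assms by simp
qed

text \<open>The index 0 stands for the character n \<mapsto> (-1/n), the index 2 for n \<mapsto> (2/n),
  and an odd prime index p for n \<mapsto> (n/p).\<close>

definition quad_char :: "nat \<Rightarrow> nat \<Rightarrow> int" where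
  "quad_char i n =
    (if i = 0 then (if even n then 0 else if n mod 4 = 1 then 1 else -1)
     else if i = 2 then (if even n then 0 else if n mod 8 \<in> {1, 7} then 1 else -1)
     else Legendre (int n) (int i))"

lemma quad_char_0: "quad_char 0 n = (if n mod 4 = 1 then 1 else if n mod 4 = 3 then -1 else 0)"
proof -
  have "odd n \<longleftrightarrow> n mod 4 = 1 \<or> n mod 4 = 3" by (simp add: odd_iff_mod_4)
  thus ?thesis by (auto simp: quad_char_def)
qed

lemma quad_char_2:
  "quad_char 2 n = (if n mod 8 \<in> {1, 7} then 1 else if n mod 8 \<in> {3, 5} then -1 else 0)"
proof -
  have "odd n \<longleftrightarrow> n mod 8 \<in> {1, 7} \<or> n mod 8 \<in> {3, 5}" unfolding odd_iff_mod_8 by blast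
  thus ?thesis unfolding quad_char_def by auto
qed

lemma quad_char_0_mult: "quad_char 0 (a * b) = quad_char 0 a * quad_char 0 b"
proof -
  define i j where "i = a mod 4" and "j = b mod 4"
  have "a mod 4 \<in> {0, 1, 2, 3}" "b mod 4 \<in> {0, 1, 2, 3}" by auto
  hence "i \<in> {0, 1, 2, 3}" "j \<in> {0, 1, 2, 3}" by (simp_all only: i_def j_def)
  note ij = this
  have "(a * b) mod 4 = (i * j) mod 4" by (simp add: mod_mult_eq i_def j_def)
  hence "quad_char 0 (a * b) = (if (i * j) mod 4 = 1 then 1 else if (i * j) mod 4 = 3 then -1 else 0)"
    unfolding quad_char_0 by (simp only:)
  also have "\<dots> = quad_char 0 a * quad_char 0 b"
    unfolding quad_char_0 i_def[symmetric] j_def[symmetric] using ij by (elim insertE emptyE) simp_all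
  finally show ?thesis .
qed

lemma quad_char_2_mult: "quad_char 2 (a * b) = quad_char 2 a * quad_char 2 b"
proof -
  define i j where "i = a mod 8" and "j = b mod 8"
  have ij: "i \<in> {0, 1, 2, 3, 4, 5, 6, 7}" "j \<in> {0, 1, 2, 3, 4, 5, 6, 7}"
    unfolding i_def j_def by (rule mod_8_cases)+
  have "(a * b) mod 8 = (i * j) mod 8" by (simp add: mod_mult_eq i_def j_def)
  hence "quad_char 2 (a * b) = (if (i * j) mod 8 \<in> {1, 7} then 1 else if (i * j) mod 8 \<in> {3, 5} then -1 else 0)"
    unfolding quad_char_2 by (simp only:)
  also have "\<dots> = quad_char 2 a * quad_char 2 b"
    unfolding quad_char_2 i_def[symmetric] j_def[symmetric] using ij by (elim insertE emptyE) simp_all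
  finally show ?thesis .
qed

lemma quad_char_prod:
  assumes i: "i = 0 \<or> i = 2" and "finite S"
  shows "quad_char i (\<Prod>S) = (\<Prod>p\<in>S. quad_char i p)"
  using assms(2)
proof (induction S rule: finite_induct)
  case empty
  show ?case using i by (auto simp: quad_char_0 quad_char_2)
next
  case (insert p S)
  have "quad_char i (p * \<Prod>S) = quad_char i p * quad_char i (\<Prod>S)"
    using i quad_char_0_mult quad_char_2_mult by blast
  thus ?case using insert by simp
qed

text \<open>All the characters have period M = 8 times the product of P. By the Chinese remainder
  theorem the required independence holds: g = 7 mod 8 negates only (-1/n), g = 5 mod 8 only (2/n),
  and a nonresidue mod p that is 1 mod M/p only (n/p). The signs (-1/q) and (2/q) together fix the
  odd residue of q mod 8.\<close>

theorem prime_with_Legendre_symbols: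
  fixes \<epsilon> :: "nat \<Rightarrow> int"
  assumes "finite P" and P: "\<And>p. p \<in> P \<Longrightarrow> prime p \<and> 2 < p"
    and \<epsilon>: "\<And>p. p \<in> P \<Longrightarrow> \<epsilon> p \<in> {-1, 1}" and r: "r \<in> {1, 3, 5, 7}"
  obtains q where "prime q" "q mod 8 = r" "\<And>p. p \<in> P \<Longrightarrow> Legendre (int q) (int p) = \<epsilon> p"
proof -
  define I where "I = {0, 2} \<union> P"
  define M where "M = 8 * \<Prod>P"
  define \<delta> where "\<delta> i = (if i = 0 \<or> i = 2 then quad_char i r else \<epsilon> i)" for i
  have notin: "0 \<notin> P" "2 \<notin> P" "1 \<notin> P" using P by fastforce+
  have char: "quad_char p n = Legendre (int n) (int p)" if "p \<in> P" for p n
    using that notin by (auto simp: quad_char_def)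
  have dvdM: "p dvd M" if "p \<in> P" for p
    using dvd_prodI[OF \<open>finite P\<close> that, of "\<lambda>p. p"] by (simp add: M_def)
  have "odd (\<Prod>P)" using P prime_odd_nat by (auto simp: even_prod_iff \<open>finite P\<close>)
  hence cop8: "coprime 8 (\<Prod>P)" using coprime_power_left_iff[of 2 3 "\<Prod>P"] by simp
  have residue_mod_8: "\<exists>g. coprime g M \<and> g mod 8 = c \<and> (\<forall>j\<in>P. Legendre (int g) (int j) = 1)"
    if c: "odd c" "c < 8" for c
  proof -
    obtain g where g: "[g = c] (mod 8)" "[g = 1] (mod \<Prod>P)"
      using binary_chinese_remainder_nat[OF cop8] by blast
    have g8: "g mod 8 = c" using g(1) c by (simp add: cong_def)
    have "odd g" using mod_8_residue(2)[OF g8] c by simp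
    hence "coprime g 8" using coprime_power_right_iff[of g 2 3] by simp
    moreover have "coprime g (\<Prod>P)" using cong_imp_coprime[OF cong_sym[OF g(2)]] by simp
    ultimately have "coprime g M" by (simp add: M_def)
    moreover have "Legendre (int g) (int j) = 1" if "j \<in> P" for j
    proof -
      have "j dvd \<Prod>P" using dvd_prodI[OF \<open>finite P\<close> that, of "\<lambda>p. p"] by simp
      hence "[g = 1] (mod j)" using g(2) cong_dvd_modulus_nat by blast
      hence "[int g = 1] (mod int j)" using cong_int_iff[of g 1 j] by simp
      thus ?thesis using Legendre_cong Legendre_1 P[OF that] by metis
    qed
    ultimately show ?thesis using g8 by blast
  qed
  have "\<exists>q. prime q \<and> coprime q M \<and> (\<forall>i\<in>I. real_of_int (quad_char i q) = real_of_int (\<delta> i))"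
  proof (rule prime_with_prescribed_signs)
    show "finite I" using \<open>finite P\<close> by (simp add: I_def)
    have "0 < p" if "p \<in> P" for p using P[OF that] by simp
    thus "0 < M" by (simp add: M_def prod_pos)
    show "real_of_int (quad_char i (Suc 0)) = 1" if "i \<in> I" for i
      using that Legendre_1 P by (auto simp: I_def quad_char_def)
    show "real_of_int (quad_char i (a * b)) = real_of_int (quad_char i a) * real_of_int (quad_char i b)"
      if "i \<in> I" for i a b
      using that P by (auto simp: I_def quad_char_0_mult quad_char_2_mult char Legendre_mult)
    show "real_of_int (quad_char i a) \<in> {-1, 0, 1}" if "i \<in> I" for i a
      using Legendre_vals[of "int a" "int i"] by (auto simp: quad_char_def)
    show "real_of_int (quad_char i (a mod M)) = real_of_int (quad_char i a)" if "i \<in> I" for i a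
    proof -
      have "4 dvd M" "8 dvd M" "2 dvd M" by (auto simp: M_def)
      moreover have "Legendre (int (a mod M)) (int i) = Legendre (int a) (int i)" if "i \<in> P"
        using dvdM[OF that] by (intro Legendre_cong) (simp add: cong_def of_nat_mod mod_mod_cancel)
      ultimately show ?thesis
        using \<open>i \<in> I\<close> by (auto simp: I_def quad_char_def mod_mod_cancel dvd_mod_iff)
    qed
    show "real_of_int (quad_char i a) \<noteq> 0" if "i \<in> I" "coprime a M" for i a
    proof -
      have "odd a" using that(2) by (auto simp: M_def)
      moreover have "\<not> i dvd a" if "i \<in> P"
        using dvdM[OF that] P[OF that] \<open>coprime a M\<close> by (metis coprime_common_divisor_nat not_prime_1)
      ultimately show ?thesis
        using that(1) by (auto simp: I_def quad_char_def Legendre_eq_0_iff)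
    qed
    show "real_of_int (\<delta> i) \<in> {-1, 1}" if "i \<in> I" for i
    proof -
      have "\<delta> 0 \<in> {-1, 1}" "\<delta> 2 \<in> {-1, 1}"
        using r by (elim insertE emptyE; simp add: \<delta>_def quad_char_def)+
      moreover have "\<delta> i = \<epsilon> i" if "i \<in> P" using that notin by (auto simp: \<delta>_def)
      ultimately have "\<delta> i \<in> {-1, 1}" using that \<epsilon>[of i] by (auto simp: I_def)
      thus ?thesis by auto
    qed
    show "\<exists>g. coprime g M \<and> real_of_int (quad_char i g) = -1 \<and> (\<forall>j\<in>I - {i}. real_of_int (quad_char j g) = 1)"
      if i: "i \<in> I" for i
    proof -
      consider "i = 0" | "i = 2" | "i \<in> P" using i by (auto simp: I_def)
      thus ?thesis
      proof cases
        case 3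
        define M' where "M' = 8 * \<Prod>(P - {i})"
        have M: "M = i * M'"
          using \<open>finite P\<close> 3 by (simp add: M_def M'_def prod.remove[of P i] mult_ac)
        have "coprime i (\<Prod>(P - {i}))"
          using P 3 by (intro prod_coprime_right) (auto intro: primes_coprime)
        moreover have "coprime i 8"
          using P[OF 3] prime_odd_nat[of i] coprime_power_right_iff[of i 2 3] by simp
        ultimately have cop: "coprime i M'" by (simp add: M'_def)
        obtain h where h: "Legendre (int h) (int i) = -1" using exists_nonresidue P[OF 3] by blast
        obtain g where g: "[g = h] (mod i)" "[g = 1] (mod M')"
          using binary_chinese_remainder_nat[OF cop] by blast
        have gi: "Legendre (int g) (int i) = -1"
          using g(1) h Legendre_cong[of "int g" "int h" "int i"] by (simp add: cong_int_iff)
        have "\<not> i dvd g" using gi Legendre_eq_0_iff[of "int g" "int i"] by auto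
        hence "coprime g i" using P[OF 3] by (metis coprime_commute prime_imp_coprime)
        moreover have "coprime g M'" using g(2) by (metis cong_imp_coprime cong_sym coprime_1_left)
        ultimately have "coprime g M" by (simp add: M)
        moreover have "quad_char j g = 1" if j: "j \<in> I - {i}" for j
        proof -
          have "[g = 1] (mod 8)" using g(2) unfolding M'_def by (rule cong_modulus_mult_nat)
          hence "g mod 8 = 1" by (simp add: cong_def)
          moreover have "odd g" "g mod 4 = 1" using mod_8_residue[OF \<open>g mod 8 = 1\<close>] by simp_all
          moreover have "Legendre (int g) (int j) = 1" if "j \<in> P"
          proof -
            have "j dvd M'" using dvd_prodI[of "P - {i}" j "\<lambda>p. p"] that j \<open>finite P\<close> by (simp add: M'_def)
            hence "[g = 1] (mod j)" using g(2) cong_dvd_modulus_nat by blast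
            hence "[int g = 1] (mod int j)" using cong_int_iff[of g 1 j] by simp
            thus ?thesis using Legendre_cong Legendre_1 P[OF that] by metis
          qed
          ultimately show ?thesis using j by (auto simp: I_def quad_char_def)
        qed
        ultimately show ?thesis using gi char[OF 3] by (intro exI[of _ g]) auto
      next
        case 1
        obtain g where g: "coprime g M" "g mod 8 = 7" "\<And>j. j \<in> P \<Longrightarrow> Legendre (int g) (int j) = 1"
          using residue_mod_8[of 7] by auto
        moreover have "odd g" "g mod 4 = 3" using mod_8_residue[OF g(2)] by simp_all
        ultimately show ?thesis using 1 char
          by (intro exI[of _ g]) (auto simp: I_def quad_char_def)
      next
        case 2
        obtain g where g: "coprime g M" "g mod 8 = 5" "\<And>j. j \<in> P \<Longrightarrow> Legendre (int g) (int j) = 1"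
          using residue_mod_8[of 5] by auto
        moreover have "odd g" "g mod 4 = 1" using mod_8_residue[OF g(2)] by simp_all
        ultimately show ?thesis using 2 char
          by (intro exI[of _ g]) (auto simp: I_def quad_char_def)
      qed
    qed
  qed
  then obtain q where q: "prime q" "coprime q M" "\<And>i. i \<in> I \<Longrightarrow> quad_char i q = \<delta> i" by auto
  have "Legendre (int q) (int p) = \<epsilon> p" if "p \<in> P" for p
    using q(3)[of p] char[OF that] that notin by (auto simp: I_def \<delta>_def)
  moreover have "q mod 8 = r"
  proof -
    have "odd q" using q(2) by (auto simp: M_def)
    hence "q mod 8 \<in> {1, 3, 5, 7}" by (simp only: odd_iff_mod_8)
    moreover have "quad_char 0 q = quad_char 0 r" "quad_char 2 q = quad_char 2 r"
      using q(3)[of 0] q(3)[of 2] by (auto simp: I_def \<delta>_def)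
    moreover have "q mod 4 = q mod 8 mod 4" by (simp add: mod_mod_cancel)
    ultimately show ?thesis using r \<open>odd q\<close> by (auto simp: quad_char_def)
  qed
  ultimately show ?thesis using q(1) that by blast
qed

section \<open>Legendre's theorem and the Davenport-Cassels descent\<close>

lemma int_sqrt_exists:
  fixes n :: int
  assumes "0 \<le> n"
  obtains s where "0 \<le> s" "s\<^sup>2 \<le> n" "n < (s + 1)\<^sup>2"
proof
  let ?s = "\<lfloor>sqrt (real_of_int n)\<rfloor>"
  show "0 \<le> ?s" using assms by simp
  have "(real_of_int ?s)\<^sup>2 \<le> (sqrt (real_of_int n))\<^sup>2"
    using assms by (intro power_mono) auto
  thus "?s\<^sup>2 \<le> n" using assms by (simp flip: of_int_power)
  have "(sqrt (real_of_int n))\<^sup>2 < (real_of_int ?s + 1)\<^sup>2"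
    using assms by (intro power_strict_mono) auto
  hence "real_of_int n < real_of_int ((?s + 1)\<^sup>2)" using assms by simp
  thus "n < (?s + 1)\<^sup>2" by (simp only: of_int_less_iff)
qed

text \<open>With sides just above the square roots of bm, am and ab, the box holds more than abm
  points, while the pair of residues takes at most abm values; two colliding points differ by the
  vector sought.\<close>

lemma pigeonhole_lattice:
  fixes a b m A B \<gamma> :: int
  assumes pos: "0 < a" "0 < b" "0 < m"
  obtains x r t where "(x, r, t) \<noteq> (0, 0, 0)" "x\<^sup>2 \<le> b * m" "r\<^sup>2 \<le> a * m" "t\<^sup>2 \<le> a * b"
    "b * m dvd x - A * r - B * t" "a dvd r - \<gamma> * t"
proof -
  obtain u where u: "0 \<le> u" "u\<^sup>2 \<le> b * m" "b * m < (u + 1)\<^sup>2" using pos by (rule_tac int_sqrt_exists[of "b * m"]) auto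
  obtain v where v: "0 \<le> v" "v\<^sup>2 \<le> a * m" "a * m < (v + 1)\<^sup>2" using pos by (rule_tac int_sqrt_exists[of "a * m"]) auto
  obtain w where w: "0 \<le> w" "w\<^sup>2 \<le> a * b" "a * b < (w + 1)\<^sup>2" using pos by (rule_tac int_sqrt_exists[of "a * b"]) auto
  define D where "D = {0..u} \<times> {0..v} \<times> {0..w}"
  define \<phi> where "\<phi> = (\<lambda>(x, r, t). ((x - A * r - B * t) mod (b * m), (r - \<gamma> * t) mod a))"
  have "(a * b * m)\<^sup>2 = (b * m) * ((a * m) * (a * b))" by (simp add: power2_eq_square)
  also have "\<dots> < (u + 1)\<^sup>2 * ((v + 1)\<^sup>2 * (w + 1)\<^sup>2)"
    using pos u v w by (intro mult_strict_mono) auto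
  also have "\<dots> = ((u + 1) * (v + 1) * (w + 1))\<^sup>2" by (simp add: power_mult_distrib)
  finally have "a * b * m < (u + 1) * (v + 1) * (w + 1)"
    using u v w by (rule_tac power2_less_imp_less) auto
  moreover have "int (card D) = (u + 1) * (v + 1) * (w + 1)"
    using u v w by (simp add: D_def card_cartesian_product)
  moreover have "int (card ({0..<b * m} \<times> {0..<a})) = a * b * m"
    using pos by (simp add: card_cartesian_product)
  ultimately have "card ({0..<b * m} \<times> {0..<a}) < card D" by linarith
  moreover have "card (\<phi> ` D) \<le> card ({0..<b * m} \<times> {0..<a})"
    using pos by (intro card_mono) (auto simp: \<phi>_def)
  ultimately have "\<not> inj_on \<phi> D" by (intro pigeonhole) linarith
  then obtain p1 p2 where p: "p1 \<in> D" "p2 \<in> D" "\<phi> p1 = \<phi> p2" "p1 \<noteq> p2" unfolding inj_on_def by blast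
  obtain x1 r1 t1 x2 r2 t2 where xs: "p1 = (x1, r1, t1)" "p2 = (x2, r2, t2)" by (metis prod_cases3)
  have sq: "(k1 - k2)\<^sup>2 \<le> n" if "k1 \<in> {0..s}" "k2 \<in> {0..s}" "s\<^sup>2 \<le> n" for k1 k2 s n :: int
  proof -
    have "\<bar>k1 - k2\<bar> \<le> \<bar>s\<bar>" using that by auto
    hence "(k1 - k2)\<^sup>2 \<le> s\<^sup>2" by (simp add: abs_le_square_iff)
    thus ?thesis using that by linarith
  qed
  show ?thesis
  proof (rule that[of "x1 - x2" "r1 - r2" "t1 - t2"])
    show "(x1 - x2, r1 - r2, t1 - t2) \<noteq> (0, 0, 0)" using p xs by auto
    show "(x1 - x2)\<^sup>2 \<le> b * m" "(r1 - r2)\<^sup>2 \<le> a * m" "(t1 - t2)\<^sup>2 \<le> a * b"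
      using p xs u v w by (auto simp: D_def intro!: sq)
    have "(x1 - A * r1 - B * t1) mod (b * m) = (x2 - A * r2 - B * t2) mod (b * m)"
      and "(r1 - \<gamma> * t1) mod a = (r2 - \<gamma> * t2) mod a"
      using p xs by (simp_all add: \<phi>_def)
    thus "b * m dvd x1 - x2 - A * (r1 - r2) - B * (t1 - t2)" "a dvd r1 - r2 - \<gamma> * (t1 - t2)"
      by (simp_all add: mod_eq_dvd_iff algebra_simps)
  qed
qed

text \<open>The lattice is chosen so that F = a x^2 + b r^2 - m t^2 is divisible on it by a, b and
  m, hence by abm. The small vector satisfies -abm < F < 2abm, leaving F = 0 or F = abm.
  \<open>nonsquare\<close> makes both bounds strict: equality would mean t^2 = ab below, and x^2 =
  bm with r^2 = am above, so that ab = (xr/m)^2.\<close>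

lemma legendre_ternary:
  fixes a b m :: int
  assumes pos: "0 < a" "0 < b" "0 < m"
    and cop: "coprime a b" "coprime a m" "coprime b m"
    and nonsquare: "\<And>s. s\<^sup>2 \<noteq> a * b"
    and \<alpha>: "[a * \<alpha>\<^sup>2 = m] (mod b)" and \<beta>: "[a * \<beta>\<^sup>2 = - b] (mod m)" and \<gamma>: "[b * \<gamma>\<^sup>2 = m] (mod a)"
  obtains x r t where "a * x\<^sup>2 + b * r\<^sup>2 = m * t\<^sup>2" "t \<noteq> 0"
proof -
  obtain A where A: "[A = \<beta>] (mod m)" "[A = 0] (mod b)"
    using binary_chinese_remainder_int[of m b \<beta> 0] cop by (auto simp: coprime_commute)
  obtain B where B: "[B = \<alpha>] (mod b)" "[B = 0] (mod m)"
    using binary_chinese_remainder_int[of b m \<alpha> 0] cop by (auto simp: coprime_commute)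
  obtain x r t where xrt: "(x, r, t) \<noteq> (0, 0, 0)" "x\<^sup>2 \<le> b * m" "r\<^sup>2 \<le> a * m" "t\<^sup>2 \<le> a * b"
    "b * m dvd x - A * r - B * t" "a dvd r - \<gamma> * t"
    by (rule pigeonhole_lattice[OF pos])
  define F where "F = a * x\<^sup>2 + b * r\<^sup>2 - m * t\<^sup>2"
  have x: "[x = A * r + B * t] (mod b * m)" using xrt(5) by (simp add: cong_iff_dvd_diff algebra_simps)
  have xb: "[x = \<alpha> * t] (mod b)"
  proof -
    have "[x = A * r + B * t] (mod b)" using x by (rule cong_modulus_mult)
    also have "[A * r + B * t = 0 * r + \<alpha> * t] (mod b)" using A B by (intro cong_add cong_mult cong_refl)
    finally show ?thesis by simp
  qed
  have xm: "[x = \<beta> * r] (mod m)"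
  proof -
    have "[x = A * r + B * t] (mod m)" using x by (metis cong_modulus_mult mult.commute)
    also have "[A * r + B * t = \<beta> * r + 0 * t] (mod m)" using A B by (intro cong_add cong_mult cong_refl)
    finally show ?thesis by simp
  qed
  have ra: "[r = \<gamma> * t] (mod a)" using xrt(6) by (simp add: cong_iff_dvd_diff)
  have "b dvd F"
  proof -
    have "[a * x\<^sup>2 = a * (\<alpha> * t)\<^sup>2] (mod b)" by (intro cong_mult cong_pow xb cong_refl)
    also have "a * (\<alpha> * t)\<^sup>2 = a * \<alpha>\<^sup>2 * t\<^sup>2" by (simp add: power_mult_distrib)
    also have "[a * \<alpha>\<^sup>2 * t\<^sup>2 = m * t\<^sup>2] (mod b)" by (intro cong_mult \<alpha> cong_refl)
    finally have "b dvd a * x\<^sup>2 - m * t\<^sup>2" by (simp add: cong_iff_dvd_diff)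
    hence "b dvd (a * x\<^sup>2 - m * t\<^sup>2) + b * r\<^sup>2" by (intro dvd_add) auto
    thus ?thesis by (simp add: F_def algebra_simps)
  qed
  moreover have "m dvd F"
  proof -
    have "[a * x\<^sup>2 = a * (\<beta> * r)\<^sup>2] (mod m)" by (intro cong_mult cong_pow xm cong_refl)
    also have "a * (\<beta> * r)\<^sup>2 = a * \<beta>\<^sup>2 * r\<^sup>2" by (simp add: power_mult_distrib)
    also have "[a * \<beta>\<^sup>2 * r\<^sup>2 = - b * r\<^sup>2] (mod m)" by (intro cong_mult \<beta> cong_refl)
    finally have "m dvd a * x\<^sup>2 + b * r\<^sup>2" by (simp add: cong_iff_dvd_diff)
    hence "m dvd (a * x\<^sup>2 + b * r\<^sup>2) - m * t\<^sup>2" by (intro dvd_diff) auto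
    thus ?thesis by (simp add: F_def)
  qed
  moreover have "a dvd F"
  proof -
    have "[b * r\<^sup>2 = b * (\<gamma> * t)\<^sup>2] (mod a)" by (intro cong_mult cong_pow ra cong_refl)
    also have "b * (\<gamma> * t)\<^sup>2 = b * \<gamma>\<^sup>2 * t\<^sup>2" by (simp add: power_mult_distrib)
    also have "[b * \<gamma>\<^sup>2 * t\<^sup>2 = m * t\<^sup>2] (mod a)" by (intro cong_mult \<gamma> cong_refl)
    finally have "a dvd b * r\<^sup>2 - m * t\<^sup>2" by (simp add: cong_iff_dvd_diff)
    hence "a dvd a * x\<^sup>2 + (b * r\<^sup>2 - m * t\<^sup>2)" by (intro dvd_add) auto
    thus ?thesis by (simp add: F_def algebra_simps)
  qed
  ultimately have "a * b * m dvd F" using cop by (intro divides_mult) auto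
  then obtain k where k: "F = a * b * m * k" by blast
  have abm: "0 < a * b * m" using pos by simp
  have ax: "a * x\<^sup>2 \<le> a * b * m" using mult_left_mono[OF xrt(2), of a] pos by (simp add: mult_ac)
  have br: "b * r\<^sup>2 \<le> a * b * m" using mult_left_mono[OF xrt(3), of b] pos by (simp add: mult_ac)
  have "t\<^sup>2 < a * b" using xrt(4) nonsquare[of t] by linarith
  hence mt: "m * t\<^sup>2 < a * b * m" using mult_strict_left_mono[of "t\<^sup>2" "a * b" m] pos by (simp add: mult_ac)
  have "- (a * b * m) < F"
  proof -
    have "0 \<le> a * x\<^sup>2" "0 \<le> b * r\<^sup>2" using pos by auto
    thus ?thesis using mt unfolding F_def by linarith
  qed
  hence "a * b * m * (-1) < a * b * m * k" using k by simp
  hence k1: "-1 < k" using abm by (simp only: mult_less_cancel_left_pos)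
  have "F < 2 * (a * b * m)"
  proof (rule ccontr)
    assume "\<not> F < 2 * (a * b * m)"
    moreover have "0 \<le> m * t\<^sup>2" using pos by auto
    ultimately have "a * x\<^sup>2 = a * b * m" "b * r\<^sup>2 = a * b * m" using ax br unfolding F_def by linarith+
    hence "x\<^sup>2 = b * m" "r\<^sup>2 = a * m" using pos by auto
    hence eq: "(x * r)\<^sup>2 = a * b * m\<^sup>2" by (simp add: power_mult_distrib) (simp add: power2_eq_square)
    hence "m\<^sup>2 dvd (x * r)\<^sup>2" by simp
    hence "m dvd x * r" by simp
    then obtain s where "x * r = m * s" by blast
    hence "s\<^sup>2 = a * b" using eq pos by (simp add: power_mult_distrib)
    thus False using nonsquare by blast
  qed
  hence "a * b * m * k < a * b * m * 2" using k by simp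
  hence "k < 2" using abm by (simp only: mult_less_cancel_left_pos)
  with k1 consider "k = 0" | "k = 1" by linarith
  thus ?thesis
  proof cases
    case 1
    hence eq: "a * x\<^sup>2 + b * r\<^sup>2 = m * t\<^sup>2" using k by (simp add: F_def)
    have "t \<noteq> 0"
    proof
      assume "t = 0"
      hence "a * x\<^sup>2 + b * r\<^sup>2 = 0" using eq by simp
      moreover have "0 \<le> a * x\<^sup>2" "0 \<le> b * r\<^sup>2" using pos by auto
      ultimately have "a * x\<^sup>2 = 0" "b * r\<^sup>2 = 0" by linarith+
      thus False using pos xrt(1) \<open>t = 0\<close> by simp
    qed
    with eq show ?thesis by (rule that)
  next
    case 2
    hence eq: "a * x\<^sup>2 + b * r\<^sup>2 = m * (t\<^sup>2 + a * b)" using k by (simp add: F_def algebra_simps)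
    \<comment> \<open>The form x^2 + a b y^2 is multiplicative, which removes the factor t^2 + a b.\<close>
    have "a * (x * t - b * r)\<^sup>2 + b * (r * t + a * x)\<^sup>2 = (a * x\<^sup>2 + b * r\<^sup>2) * (t\<^sup>2 + a * b)"
      by (simp add: algebra_simps power2_eq_square)
    also have "\<dots> = m * (t\<^sup>2 + a * b)\<^sup>2" unfolding eq by (simp add: power2_eq_square)
    finally show ?thesis
    proof (rule that)
      have "0 < a * b" using pos by simp
      moreover have "0 \<le> t\<^sup>2" by simp
      ultimately show "t\<^sup>2 + a * b \<noteq> 0" by linarith
    qed
  qed
qed

section \<open>The Davenport-Cassels descent for a x^2 + N\<close>

definition eisenstein_norm :: "int \<Rightarrow> int \<Rightarrow> int" where
  "eisenstein_norm z w = z\<^sup>2 + z * w + w\<^sup>2"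

lemma eisenstein_norm_eq: "4 * eisenstein_norm z w = (2 * z + w)\<^sup>2 + 3 * w\<^sup>2"
  by (simp add: eisenstein_norm_def power2_eq_square algebra_simps)

lemma eisenstein_norm_nonneg: "0 \<le> eisenstein_norm z w"
  using eisenstein_norm_eq[of z w] zero_le_power2[of "2 * z + w"] zero_le_power2[of w] by linarith

lemma eisenstein_norm_zero_iff: "eisenstein_norm z w = 0 \<longleftrightarrow> z = 0 \<and> w = 0"
proof
  assume "eisenstein_norm z w = 0"
  hence "(2 * z + w)\<^sup>2 + 3 * w\<^sup>2 = 0" using eisenstein_norm_eq[of z w] by simp
  hence "w\<^sup>2 = 0" "(2 * z + w)\<^sup>2 = 0"
    using zero_le_power2[of "2 * z + w"] zero_le_power2[of w] by linarith+
  thus "z = 0 \<and> w = 0" by simp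
qed (simp add: eisenstein_norm_def)

lemma round_div:
  fixes x t :: int
  assumes "0 < t"
  obtains X where "4 * (x - t * X)\<^sup>2 \<le> t\<^sup>2"
proof
  let ?X = "(2 * x + t) div (2 * t)"
  have "(2 * x + t) = 2 * t * ?X + (2 * x + t) mod (2 * t)" by simp
  moreover have "0 \<le> (2 * x + t) mod (2 * t)" "(2 * x + t) mod (2 * t) < 2 * t" using assms by auto
  ultimately have "- t \<le> 2 * (x - t * ?X)" "2 * (x - t * ?X) \<le> t" by (auto simp: algebra_simps)
  hence "\<bar>2 * (x - t * ?X)\<bar> \<le> \<bar>t\<bar>" by linarith
  hence "(2 * (x - t * ?X))\<^sup>2 \<le> t\<^sup>2" by (simp only: abs_le_square_iff)
  thus "4 * (x - t * ?X)\<^sup>2 \<le> t\<^sup>2" by (simp only: power_mult_distrib) simp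
qed

text \<open>In 4N = (2z + w)^2 + 3w^2 the quantity to keep small is 2z + w, so Z is chosen after w
  has been rounded. Then N is at most 7/16 of t^2; rounding z and w separately guarantees only 3/4,
  too much for the descent.\<close>

lemma round_div_half:
  fixes z w' t :: int
  assumes "0 < t"
  obtains Z where "(2 * (z - t * Z) + w')\<^sup>2 \<le> t\<^sup>2"
proof
  let ?Z = "(2 * z + w' + t) div (2 * t)"
  have "(2 * z + w' + t) = 2 * t * ?Z + (2 * z + w' + t) mod (2 * t)" by simp
  moreover have "0 \<le> (2 * z + w' + t) mod (2 * t)" "(2 * z + w' + t) mod (2 * t) < 2 * t" using assms by auto
  ultimately have "- t \<le> 2 * (z - t * ?Z) + w'" "2 * (z - t * ?Z) + w' \<le> t" by (auto simp: algebra_simps)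
  hence "\<bar>2 * (z - t * ?Z) + w'\<bar> \<le> \<bar>t\<bar>" by linarith
  thus "(2 * (z - t * ?Z) + w')\<^sup>2 \<le> t\<^sup>2" by (simp only: abs_le_square_iff)
qed

lemma davenport_cassels:
  fixes a m x z w t :: int
  assumes a: "0 < a" "a \<le> 2" and "t \<noteq> 0" and "a * x\<^sup>2 + eisenstein_norm z w = m * t\<^sup>2"
  shows "\<exists>x z w. m = a * x\<^sup>2 + eisenstein_norm z w"
  using assms(3,4)
proof (induction "nat \<bar>t\<bar>" arbitrary: t x z w rule: less_induct)
  case less
  define T where "T = \<bar>t\<bar>"
  have T: "0 < T" "T\<^sup>2 = t\<^sup>2" using less.prems by (auto simp: T_def)
  have rep: "a * x\<^sup>2 + eisenstein_norm z w = m * T\<^sup>2" using less.prems T by simp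
  obtain X where X: "4 * (x - T * X)\<^sup>2 \<le> T\<^sup>2" using round_div[OF T(1)] .
  obtain W where W: "4 * (w - T * W)\<^sup>2 \<le> T\<^sup>2" using round_div[OF T(1)] .
  obtain Z where Z: "(2 * (z - T * Z) + (w - T * W))\<^sup>2 \<le> T\<^sup>2" using round_div_half[OF T(1)] .
  define f where "f = a * (x - T * X)\<^sup>2 + eisenstein_norm (z - T * Z) (w - T * W)"
  have f_nonneg: "0 \<le> a * (x - T * X)\<^sup>2" "0 \<le> eisenstein_norm (z - T * Z) (w - T * W)"
    using a eisenstein_norm_nonneg by auto
  \<comment> \<open>With a <= 2 the three rounding bounds give f <= (1/2 + 1/4 + 3/16) T^2 = (15/16)
    T^2.\<close>
  have "a * (x - T * X)\<^sup>2 \<le> 2 * (x - T * X)\<^sup>2" using a by (intro mult_right_mono) auto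
  hence "f < T\<^sup>2"
    using eisenstein_norm_eq[of "z - T * Z" "w - T * W"] X W Z zero_less_power[OF T(1), of 2]
    unfolding f_def by linarith
  show ?case
  proof (cases "f = 0")
    case True
    hence "a * (x - T * X)\<^sup>2 = 0" "eisenstein_norm (z - T * Z) (w - T * W) = 0"
      using f_nonneg unfolding f_def by linarith+
    hence "x = T * X" "z = T * Z" "w = T * W" using a by (auto simp: eisenstein_norm_zero_iff)
    hence "(a * X\<^sup>2 + eisenstein_norm Z W) * T\<^sup>2 = m * T\<^sup>2"
      using rep by (simp add: eisenstein_norm_def power2_eq_square algebra_simps)
    hence "m = a * X\<^sup>2 + eisenstein_norm Z W" using less.prems(1) T(2) by auto
    thus ?thesis by blast
  next
    case False
    hence "0 < f" using f_nonneg unfolding f_def by linarith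
    \<comment> \<open>The line through (x, z, w)/T and the lattice point (X, Z, W) meets the quadric again in a point
      with the smaller denominator t' = f/T.\<close>
    define P where "P = a * X\<^sup>2 + eisenstein_norm Z W - m"
    \<comment> \<open>\<open>b\<close> is the polar form at (x, z, w) and (X, Z, W). Expanding f
      with it, and using that the form at (x, z, w) is m T^2, gives f = T t'.\<close>
    define b where "b = 2 * a * x * X + 2 * z * Z + z * W + w * Z + 2 * w * W"
    define Q where "Q = 2 * m * T - b"
    define t' where "t' = P * T + Q"
    have "T * t' = f"
    proof -
      have "f = T\<^sup>2 * (P + m) - T * b + (a * x\<^sup>2 + eisenstein_norm z w)"
        by (simp add: f_def P_def b_def eisenstein_norm_def power2_eq_square algebra_simps)
      thus ?thesis unfolding rep t'_def Q_def by (simp add: power2_eq_square algebra_simps)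
    qed
    hence "0 < T * t'" "T * t' < T * T" using \<open>0 < f\<close> \<open>f < T\<^sup>2\<close> by (simp_all add: power2_eq_square)
    hence t': "0 < t'" "t' < T" using T by (simp_all add: zero_less_mult_iff)
    have "a * (P * x + Q * X)\<^sup>2 + eisenstein_norm (P * z + Q * Z) (P * w + Q * W) =
        P\<^sup>2 * (a * x\<^sup>2 + eisenstein_norm z w) + P * Q * b + Q\<^sup>2 * (a * X\<^sup>2 + eisenstein_norm Z W)"
      by (simp add: b_def eisenstein_norm_def power2_eq_square algebra_simps)
    also have "\<dots> = P\<^sup>2 * (m * T\<^sup>2) + P * Q * (2 * m * T - Q) + Q\<^sup>2 * (P + m)"
      by (simp add: rep P_def Q_def)
    also have "\<dots> = m * t'\<^sup>2"
      by (simp add: t'_def power2_eq_square algebra_simps)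
    finally show ?thesis
      using less.hyps[of t'] t' by (auto simp: T_def)
  qed
qed

text \<open>Since u^2 + 3v^2 = N(u - v, 2v), multiplying by s^2 turns q r^2 into a value of N; the
  common denominator is then t s.\<close>

lemma representation_from_rational:
  fixes a m q :: int
  assumes a: "0 < a" "a \<le> 2" and m: "a * x\<^sup>2 + q * r\<^sup>2 = m * t\<^sup>2" "t \<noteq> 0"
    and q: "u\<^sup>2 + 3 * v\<^sup>2 = q * s\<^sup>2" "s \<noteq> 0"
  shows "\<exists>x z w. m = a * x\<^sup>2 + eisenstein_norm z w"
proof (rule davenport_cassels[OF a])
  show "t * s \<noteq> 0" using m q by simp
  have "a * (x * s)\<^sup>2 + eisenstein_norm (r * (u - v)) (2 * r * v) = a * x\<^sup>2 * s\<^sup>2 + r\<^sup>2 * (u\<^sup>2 + 3 * v\<^sup>2)"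
    by (simp add: eisenstein_norm_def power2_eq_square algebra_simps)
  also have "\<dots> = (a * x\<^sup>2 + q * r\<^sup>2) * s\<^sup>2" unfolding q by (simp add: algebra_simps)
  also have "\<dots> = m * (t * s)\<^sup>2" unfolding m by (simp add: power_mult_distrib)
  finally show "a * (x * s)\<^sup>2 + eisenstein_norm (r * (u - v)) (2 * r * v) = m * (t * s)\<^sup>2" .
qed

lemma prime_times_not_square:
  assumes "prime q" "\<not> int q dvd a"
  shows "s\<^sup>2 \<noteq> a * int q"
proof
  assume eq: "s\<^sup>2 = a * int q"
  hence "int q dvd s * s" by (simp add: power2_eq_square)
  hence "int q dvd s" using assms(1) by (simp add: prime_dvd_mult_iff)
  then obtain k where "s = int q * k" by blast
  hence "int q * (int q * k\<^sup>2) = int q * a" using eq by (simp add: power2_eq_square mult_ac)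
  hence "int q * k\<^sup>2 = a" using assms(1) prime_gt_0_nat by simp
  thus False using assms(2) by auto
qed

text \<open>Multiplied by a, the equation reads (a y)^2 = a c, so a root of ac is divided by
  a.\<close>

lemma solve_quadratic_mod_prime:
  assumes "prime p" "2 < p" "Legendre (a * c) (int p) = 1"
  shows "\<exists>y. [a * y\<^sup>2 = c] (mod int p)"
proof -
  obtain y where y: "[y\<^sup>2 = a * c] (mod int p)"
    using assms(3) by (auto simp: Legendre_def QuadRes_def split: if_splits)
  have "\<not> int p dvd a" using assms(3) Legendre_eq_0_iff[of "a * c" "int p"] by auto
  moreover have "prime (int p)" using assms(1) by simp
  ultimately have "coprime a (int p)" by (metis coprime_commute prime_imp_coprime)
  then obtain b where b: "[a * b = 1] (mod int p)" using cong_solve_coprime_int by blast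
  have "a * (b * y)\<^sup>2 = a * b * b * y\<^sup>2" by (simp add: power2_eq_square)
  also have "[a * b * b * y\<^sup>2 = 1 * b * (a * c)] (mod int p)"
    by (intro cong_mult b y cong_refl)
  also have "1 * b * (a * c) = (a * b) * c" by simp
  also have "[(a * b) * c = 1 * c] (mod int p)" by (intro cong_mult b cong_refl)
  finally show ?thesis by auto
qed

lemma solve_quadratic_mod_prod:
  fixes a c :: int
  assumes "finite S" "\<And>p. p \<in> S \<Longrightarrow> prime p" "\<And>p. p \<in> S \<Longrightarrow> \<exists>y. [a * y\<^sup>2 = c] (mod int p)"
  shows "\<exists>y. [a * y\<^sup>2 = c] (mod int (\<Prod>S))"
  using assms
proof (induction S rule: finite_induct)
  case (insert p S)
  obtain y1 where y1: "[a * y1\<^sup>2 = c] (mod int p)" using insert.prems by blast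
  obtain y2 where y2: "[a * y2\<^sup>2 = c] (mod int (\<Prod>S))" using insert by blast
  have "coprime p (\<Prod>S)"
    using insert.hyps insert.prems(1) by (intro prod_coprime_right) (auto intro!: primes_coprime)
  hence cop: "coprime (int p) (int (\<Prod>S))" by (simp only: coprime_int_iff)
  obtain y where y: "[y = y1] (mod int p)" "[y = y2] (mod int (\<Prod>S))"
    using binary_chinese_remainder_int[OF cop] by blast
  have "[a * y\<^sup>2 = c] (mod int p)"
    using cong_trans[OF cong_mult[OF cong_refl cong_pow[OF y(1)]] y1] .
  moreover have "[a * y\<^sup>2 = c] (mod int (\<Prod>S))"
    using cong_trans[OF cong_mult[OF cong_refl cong_pow[OF y(2)]] y2] .
  ultimately have "[a * y\<^sup>2 = c] (mod int p * int (\<Prod>S))"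
    using cop by (rule coprime_cong_mult)
  thus ?case using insert.hyps by auto
qed auto

lemma solve_quadratic_mod_2:
  assumes "odd (a::int)"
  shows "\<exists>y. [a * y\<^sup>2 = c] (mod 2)"
proof (cases "even c")
  case True
  thus ?thesis by (intro exI[of _ 0]) (simp add: cong_def even_iff_mod_2_eq_zero)
next
  case False
  thus ?thesis using assms by (intro exI[of _ 1]) (simp add: cong_def odd_iff_mod_2_eq_one)
qed

text \<open>Legendre's theorem for x^2 + 3r^2 = q t^2: its condition mod 3 is (q/3) = 1, and its
  condition mod q, (-3/q) = 1, is the same by \<open>Legendre_minus_3\<close>.\<close>

lemma prime_eq_eisenstein_norm_rational:
  assumes "prime q" "3 < q" "Legendre (int q) 3 = 1"
  obtains u v s :: int where "u\<^sup>2 + 3 * v\<^sup>2 = int q * s\<^sup>2" "s \<noteq> 0"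
proof -
  have "\<exists>y. [1 * y\<^sup>2 = - 3] (mod int q)"
    using assms by (intro solve_quadratic_mod_prime) (auto simp: Legendre_minus_3)
  moreover have "\<exists>y. [1 * y\<^sup>2 = int q] (mod int 3)"
    using assms by (intro solve_quadratic_mod_prime) auto
  moreover have "\<not> 3 dvd q" using assms primes_dvd_imp_eq[of 3 q] by auto
  hence "coprime 3 q" by (intro prime_imp_coprime) auto
  hence "coprime (int 3) (int q)" by (simp only: coprime_int_iff)
  moreover have "s\<^sup>2 \<noteq> 1 * (3::int)" for s
    using prime_times_not_square[of 3 1 s] by auto
  ultimately obtain \<alpha> \<beta> where "[1 * \<alpha>\<^sup>2 = int q] (mod 3)" "[1 * \<beta>\<^sup>2 = - 3] (mod int q)"
    and cop: "coprime 3 (int q)" and nsq: "\<And>s. s\<^sup>2 \<noteq> 1 * (3::int)" by auto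
  moreover have "0 < int q" using assms by simp
  moreover have "[3 * 0\<^sup>2 = int q] (mod 1)" by simp
  ultimately obtain x r t where "1 * x\<^sup>2 + 3 * r\<^sup>2 = int q * t\<^sup>2" "t \<noteq> 0"
    using legendre_ternary[OF zero_less_one zero_less_numeral _ coprime_1_left coprime_1_left cop nsq] by metis
  thus ?thesis by (intro that) simp_all
qed

section \<open>The two ternary forms\<close>

definition rep1 :: "int \<Rightarrow> bool" where "rep1 m \<longleftrightarrow> (\<exists>x z w. m = x\<^sup>2 + eisenstein_norm z w)"
definition rep2 :: "int \<Rightarrow> bool" where "rep2 m \<longleftrightarrow> (\<exists>x z w. m = 2 * x\<^sup>2 + eisenstein_norm z w)"

lemma eisenstein_norm_scale: "eisenstein_norm (s * z) (s * w) = s\<^sup>2 * eisenstein_norm z w"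
  by (simp add: eisenstein_norm_def power2_eq_square algebra_simps)

lemma rep1_scale:
  assumes "rep1 m"
  shows "rep1 (s\<^sup>2 * m)"
proof -
  obtain x z w where "m = x\<^sup>2 + eisenstein_norm z w" using assms unfolding rep1_def by blast
  hence "s\<^sup>2 * m = (s * x)\<^sup>2 + eisenstein_norm (s * z) (s * w)"
    by (simp add: eisenstein_norm_scale power_mult_distrib distrib_left)
  thus ?thesis unfolding rep1_def by blast
qed

lemma rep2_scale:
  assumes "rep2 m"
  shows "rep2 (s\<^sup>2 * m)"
proof -
  obtain x z w where "m = 2 * x\<^sup>2 + eisenstein_norm z w" using assms unfolding rep2_def by blast
  hence "s\<^sup>2 * m = 2 * (s * x)\<^sup>2 + eisenstein_norm (s * z) (s * w)"
    by (simp add: eisenstein_norm_scale power_mult_distrib distrib_left)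
  thus ?thesis unfolding rep2_def by blast
qed

lemma coprime_prime_prod:
  fixes S :: "nat set"
  assumes "finite S" "\<And>p. p \<in> S \<Longrightarrow> prime p" "prime q" "q \<notin> S"
  shows "coprime q (\<Prod>S)"
  using assms by (intro prod_coprime_right) (auto intro!: primes_coprime)

text \<open>For x^2 + q r^2 = m t^2 one needs -q to be a square mod each p | m, which dictates (q/p)
  = (-1/p) for odd p, and m to be a square mod q. With q = 7 mod 8 the latter is automatic: (2/q) =
  1, and for odd p reciprocity gives (p/q) = (-1/p)(q/p) = 1. At p = 3 this rule would ask for (q/3)
  = -1, contrary to the (q/3) = 1 that makes q a rational norm; hence 3 is kept out of S.\<close>

lemma rep1_prod:
  fixes S :: "nat set"
  assumes S: "finite S" "\<And>p. p \<in> S \<Longrightarrow> prime p" "3 \<notin> S"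
  shows "rep1 (int (\<Prod>S))"
proof -
  define P where "P = insert 3 (S - {2})"
  define \<epsilon> where "\<epsilon> p = (if p = 3 then 1 else Legendre (-1) (int p))" for p
  have P: "prime p \<and> 2 < p" if "p \<in> P" for p
    using that S prime_ge_2_nat[of p] by (auto simp: P_def le_neq_implies_less)
  have "\<epsilon> p \<in> {-1, 1}" if "p \<in> P" for p
    using Legendre_eq_pm1[of "int p" "-1"] P[OF that] by (auto simp: \<epsilon>_def)
  moreover have "finite P" using S by (simp add: P_def)
  ultimately obtain q where q: "prime q" "q mod 8 = 7" "\<And>p. p \<in> P \<Longrightarrow> Legendre (int q) (int p) = \<epsilon> p"
    using prime_with_Legendre_symbols[of P \<epsilon> 7] P by (metis insertCI)
  have q4: "q mod 4 = 3" using mod_8_residue(1)[OF q(2)] by simp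
  have "2 < q" using q(2) prime_ge_2_nat[OF q(1)] by (cases "q = 2") auto
  have q3: "Legendre (int q) 3 = 1" using q(3)[of 3] by (simp add: P_def \<epsilon>_def)
  have "q \<noteq> 3" using q(2) by auto
  hence "3 < q" using \<open>2 < q\<close> by simp
  have "Legendre (int q) (int p) = Legendre (-1) (int p)" if "p \<in> S" "p \<noteq> 2" for p
    using q(3)[of p] that S by (auto simp: P_def \<epsilon>_def)
  note qp = this
  have neq: "p \<noteq> q" if "p \<in> S" for p
  proof
    assume "p = q"
    hence "Legendre (int q) (int q) = Legendre (-1) (int q)" using qp[of q] that \<open>2 < q\<close> by auto
    thus False using Legendre_eq_0_iff[of "int q" "int q"] Legendre_eq_0_iff[of "-1" "int q"] \<open>2 < q\<close> by auto
  qed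
  have pq: "Legendre (int p) (int q) = 1" if p: "p \<in> S" for p
  proof (cases "p = 2")
    case True
    thus ?thesis using Legendre_2[OF q(1) \<open>2 < q\<close>] q(2) by simp
  next
    case False
    hence "2 < p" using S(2)[OF p] prime_ge_2_nat[of p] by simp
    have "\<not> int p dvd -1" using \<open>2 < p\<close> by auto
    thus ?thesis
      using Legendre_swap[OF S(2)[OF p] \<open>2 < p\<close> q(1) \<open>2 < q\<close> neq[OF p]] q4 qp[OF p False]
      by (simp add: Legendre_self_mult)
  qed
  have "Legendre (int (\<Prod>S)) (int q) = 1"
    unfolding Legendre_prod[OF q(1) \<open>2 < q\<close> S(1)] using pq by (intro prod.neutral) auto
  hence \<alpha>: "\<exists>y. [1 * y\<^sup>2 = int (\<Prod>S)] (mod int q)"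
    using q \<open>2 < q\<close> by (intro solve_quadratic_mod_prime) auto
  have \<beta>: "\<exists>y. [1 * y\<^sup>2 = - int q] (mod int (\<Prod>S))"
  proof (rule solve_quadratic_mod_prod[OF S(1,2)])
    fix p assume p: "p \<in> S"
    show "\<exists>y. [1 * y\<^sup>2 = - int q] (mod int p)"
    proof (cases "p = 2")
      case True
      thus ?thesis using solve_quadratic_mod_2[of 1] by simp
    next
      case False
      hence "2 < p" using S(2)[OF p] prime_ge_2_nat[of p] by simp
      have "\<not> int p dvd -1" using \<open>2 < p\<close> by auto
      moreover have "Legendre (-1 * int q) (int p) = Legendre (-1) (int p) * Legendre (int q) (int p)"
        using S(2)[OF p] \<open>2 < p\<close> by (rule Legendre_mult)
      ultimately have "Legendre (1 * (- int q)) (int p) = 1" using qp[OF p False] by (simp add: Legendre_self_mult)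
      thus ?thesis using S(2)[OF p] \<open>2 < p\<close> by (intro solve_quadratic_mod_prime) auto
    qed
  qed
  have cop: "coprime (int q) (int (\<Prod>S))"
    unfolding coprime_int_iff using coprime_prime_prod[OF S(1,2) q(1)] neq by blast
  have "0 < \<Prod>S" using S(2) prime_gt_0_nat by (intro prod_pos) auto
  hence S0: "0 < int (\<Prod>S)" by linarith
  have nsq: "s\<^sup>2 \<noteq> 1 * int q" for s
    using \<open>2 < q\<close> by (intro prime_times_not_square q) auto
  obtain \<alpha> \<beta> where ab: "[1 * \<alpha>\<^sup>2 = int (\<Prod>S)] (mod int q)" "[1 * \<beta>\<^sup>2 = - int q] (mod int (\<Prod>S))"
    using \<alpha> \<beta> by blast
  obtain x r t where xrt: "1 * x\<^sup>2 + int q * r\<^sup>2 = int (\<Prod>S) * t\<^sup>2" "t \<noteq> 0"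
    using legendre_ternary[OF _ _ S0 _ _ cop nsq ab, of 1] \<open>2 < q\<close> by auto
  obtain u v s where uvs: "u\<^sup>2 + 3 * v\<^sup>2 = int q * s\<^sup>2" "s \<noteq> 0"
    using prime_eq_eisenstein_norm_rational[OF q(1) \<open>3 < q\<close> q3] by blast
  show ?thesis
    using representation_from_rational[OF _ _ xrt uvs] by (simp add: rep1_def)
qed

lemma Legendre_minus_1_quad_char: "prime p \<Longrightarrow> 2 < p \<Longrightarrow> Legendre (-1) (int p) = quad_char 0 p"
proof -
  assume p: "prime p" "2 < p"
  have "odd p" using p prime_odd_nat by simp
  hence "even ((p - 1) div 2) \<longleftrightarrow> p mod 4 = 1" by (rule even_half_pred_iff)
  thus ?thesis using p \<open>odd p\<close> by (simp add: Legendre_minus_1 quad_char_def minus_one_power_iff)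
qed

lemma Legendre_2_quad_char: "prime p \<Longrightarrow> 2 < p \<Longrightarrow> Legendre 2 (int p) = quad_char 2 p"
  using prime_odd_nat[of p] by (simp add: Legendre_2 quad_char_def)

text \<open>Both 2x^2 = -q and x^2 = -2q mod p ask for (-2q/p) = 1, so one prime q serves m and 2m.
  The rule (q/p) = (-2/p) agrees with (q/3) = 1 because -2 = 1 mod 3, so 3 may belong to S.
  Reciprocity turns (p/q) into (2/p) if q = 7 mod 8, and into (-2/p) if q = 1 or 5.\<close>

lemma auxiliary_prime:
  fixes S :: "nat set"
  assumes S: "finite S" "\<And>p. p \<in> S \<Longrightarrow> prime p \<and> 2 < p" and r: "r \<in> {1, 5, 7}"
  obtains q where "prime q" "3 < q" "q \<notin> S" "q mod 8 = r" "Legendre (int q) 3 = 1"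
    "\<And>p. p \<in> S \<Longrightarrow> Legendre (-2 * int q) (int p) = 1"
    "Legendre (int (\<Prod>S)) (int q) = (if r = 7 then 1 else quad_char 0 (\<Prod>S)) * quad_char 2 (\<Prod>S)"
proof -
  define P where "P = insert 3 S"
  have P: "prime p \<and> 2 < p" if "p \<in> P" for p
    using that S by (auto simp: P_def)
  have ndvd: "\<not> int p dvd -2" "\<not> int p dvd -1" if "p \<in> P" for p
    using P[OF that] zdvd_imp_le[of "int p" 2] by auto
  have "Legendre (-2) (int p) \<in> {-1, 1}" if "p \<in> P" for p
    using Legendre_eq_pm1 ndvd[OF that] by blast
  moreover have "finite P" using S by (simp add: P_def)
  ultimately obtain q where q: "prime q" "q mod 8 = r" "\<And>p. p \<in> P \<Longrightarrow> Legendre (int q) (int p) = Legendre (-2) (int p)"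
    using prime_with_Legendre_symbols[of P "\<lambda>p. Legendre (-2) (int p)" r] P r by blast
  have "2 < q" using q(2) r prime_ge_2_nat[OF q(1)] by (cases "q = 2") auto
  moreover have "q \<noteq> 3" using q(2) r by auto
  ultimately have "3 < q" by simp
  have "[-2 = 1] (mod (3::int))" by (simp add: cong_def)
  hence "Legendre (-2) 3 = 1" using Legendre_cong Legendre_1[of 3] by fastforce
  hence q3: "Legendre (int q) 3 = 1" using q(3)[of 3] by (simp add: P_def)
  have neq: "q \<noteq> p" if "p \<in> P" for p
    using q(3)[OF that] ndvd[OF that] Legendre_eq_0_iff[of "int q" "int p"] Legendre_eq_0_iff[of "-2" "int p"] by auto
  have m2q: "Legendre (-2 * int q) (int p) = 1" if "p \<in> S" for p
  proof -
    have p: "p \<in> P" using that by (simp add: P_def)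
    show ?thesis
      using Legendre_mult[of p "-2" "int q"] P[OF p] q(3)[OF p] Legendre_self_mult ndvd[OF p] by simp
  qed
  have swap: "Legendre (int p) (int q) = (if r = 7 then 1 else quad_char 0 p) * quad_char 2 p" if "p \<in> S" for p
  proof -
    have pP: "p \<in> P" using that by (simp add: P_def)
    have p: "prime p" "2 < p" using P[OF pP] by auto
    have "Legendre (-1 * 2) (int p) = Legendre (-1) (int p) * Legendre 2 (int p)"
      by (rule Legendre_mult[OF p])
    hence "Legendre (int q) (int p) = Legendre (-1) (int p) * Legendre 2 (int p)"
      using q(3)[OF pP] by simp
    moreover have "q mod 4 = q mod 8 mod 4" by (simp add: mod_mod_cancel)
    hence "q mod 4 = 1 \<longleftrightarrow> r \<noteq> 7" using r unfolding q(2) by auto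
    ultimately show ?thesis
      using Legendre_swap[OF p q(1) \<open>2 < q\<close>] neq[OF pP] Legendre_self_mult[OF ndvd(2)[OF pP]]
      by (auto simp: Legendre_minus_1_quad_char[OF p] Legendre_2_quad_char[OF p] mult.assoc[symmetric])
  qed
  have "Legendre (int (\<Prod>S)) (int q) = (\<Prod>p\<in>S. (if r = 7 then 1 else quad_char 0 p) * quad_char 2 p)"
    unfolding Legendre_prod[OF q(1) \<open>2 < q\<close> S(1)] by (intro prod.cong) (simp_all add: swap)
  also have "\<dots> = (if r = 7 then 1 else quad_char 0 (\<Prod>S)) * quad_char 2 (\<Prod>S)"
    by (simp add: prod.distrib quad_char_prod[OF _ S(1)])
  finally show ?thesis using that[OF q(1) \<open>3 < q\<close> _ q(2) q3 m2q] neq by (auto simp: P_def)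
qed

lemma rep2_prod:
  fixes S :: "nat set"
  assumes S: "finite S" "\<And>p. p \<in> S \<Longrightarrow> prime p \<and> 2 < p"
  shows "rep2 (int (\<Prod>S))" and "(\<Prod>S) mod 8 \<noteq> 5 \<Longrightarrow> rep2 (2 * int (\<Prod>S))"
proof -
  define m where "m = \<Prod>S"
  have m_odd: "odd m" using S(2) prime_odd_nat by (auto simp: m_def even_prod_iff S(1))
  have m0: "0 < int m" using m_odd by (auto intro: Nat.gr0I)
  \<comment> \<open>The choice ensures (2m/q) = 1. For m = 1, 3, 7 mod 8 both (m/q) and (2/q) are 1.
    For m = 5 the symbol (m/q) is -1, which r = 5 offsets by (2/q) = -1; it remains an obstacle for
    2m.\<close>
  define r :: nat where "r = (if m mod 8 = 7 then 7 else if m mod 8 = 5 then 5 else 1)"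
  have r: "r \<in> {1, 5, 7}" by (simp add: r_def)
  obtain q where q: "prime q" "3 < q" "q \<notin> S" "q mod 8 = r" "Legendre (int q) 3 = 1"
    "\<And>p. p \<in> S \<Longrightarrow> Legendre (-2 * int q) (int p) = 1"
    "Legendre (int m) (int q) = (if r = 7 then 1 else quad_char 0 m) * quad_char 2 m"
    unfolding m_def using auxiliary_prime[OF S r] by blast
  have q2: "2 < q" using q by simp
  have m8: "m mod 8 \<in> {1, 3, 5, 7}" using m_odd by (simp only: odd_iff_mod_8)
  have "m mod 4 = m mod 8 mod 4" by (simp add: mod_mod_cancel)
  hence m_res: "Legendre (int m) (int q) = (if m mod 8 = 5 then -1 else 1)"
    using q(7) m8 m_odd by (auto simp: r_def quad_char_def)
  have q_odd: "odd q" using q(1) q2 prime_odd_nat by simp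
  have cop: "coprime (int q) (int m)"
    unfolding coprime_int_iff m_def using S(2) by (intro coprime_prime_prod S(1) q) auto
  have cop2: "coprime 2 (int q)" "coprime 2 (int m)" using q_odd m_odd by auto
  have ndvd: "\<not> int q dvd 2" using zdvd_imp_le[of "int q" 2] q2 by auto
  have nsq: "s\<^sup>2 \<noteq> 2 * int q" for s using prime_times_not_square[OF q(1) ndvd] .
  obtain u v s where uvs: "u\<^sup>2 + 3 * v\<^sup>2 = int q * s\<^sup>2" "s \<noteq> 0"
    using prime_eq_eisenstein_norm_rational[OF q(1,2,5)] by blast
  show "rep2 (int (\<Prod>S))"
  proof -
    have "Legendre 2 (int q) = (if m mod 8 = 5 then -1 else 1)"
      using q(4) m8 by (auto simp: Legendre_2[OF q(1) q2] r_def)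
    hence "Legendre (2 * int m) (int q) = 1"
      using Legendre_mult[OF q(1) q2, of 2 "int m"] m_res by simp
    then obtain \<alpha> where \<alpha>: "[2 * \<alpha>\<^sup>2 = int m] (mod int q)"
      using solve_quadratic_mod_prime[OF q(1) q2] by blast
    have "\<exists>y. [2 * y\<^sup>2 = - int q] (mod int m)"
      unfolding m_def
    proof (rule solve_quadratic_mod_prod[OF S(1)])
      fix p assume "p \<in> S"
      thus "\<exists>y. [2 * y\<^sup>2 = - int q] (mod int p)"
        using S(2) q(6) by (intro solve_quadratic_mod_prime) auto
    qed (use S in auto)
    then obtain \<beta> where \<beta>: "[2 * \<beta>\<^sup>2 = - int q] (mod int m)" by blast
    obtain \<gamma> where \<gamma>: "[int q * \<gamma>\<^sup>2 = int m] (mod 2)"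
      using solve_quadratic_mod_2[of "int q"] q_odd by auto
    obtain x r t where xrt: "2 * x\<^sup>2 + int q * r\<^sup>2 = int m * t\<^sup>2" "t \<noteq> 0"
      using legendre_ternary[OF _ _ m0 cop2 cop nsq \<alpha> \<beta> \<gamma>] q2 by auto
    show ?thesis
      using representation_from_rational[OF _ _ xrt uvs] by (simp add: rep2_def m_def)
  qed
  show "rep2 (2 * int (\<Prod>S))" if "(\<Prod>S) mod 8 \<noteq> 5"
  proof -
    \<comment> \<open>In 2x^2 + q r^2 = 2m t^2 the coefficients are not coprime, but r must be even;
      halving leads to x^2 + 2q r^2 = m t^2, to which Legendre's theorem applies with b =
      2q.\<close>
    have "\<exists>y. [1 * y\<^sup>2 = int m] (mod int (\<Prod>{2, q}))"
    proof (rule solve_quadratic_mod_prod)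
      fix p assume "p \<in> {2, q}"
      moreover have "Legendre (1 * int m) (int q) = 1" using m_res that by (simp add: m_def)
      hence "\<exists>y. [1 * y\<^sup>2 = int m] (mod int q)" by (rule solve_quadratic_mod_prime[OF q(1) q2])
      ultimately show "\<exists>y. [1 * y\<^sup>2 = int m] (mod int p)"
        using solve_quadratic_mod_2[of 1 "int m"] by auto
    qed (use q in auto)
    then obtain \<alpha> where \<alpha>: "[1 * \<alpha>\<^sup>2 = int m] (mod 2 * int q)" using q2 by auto
    have "\<exists>y. [1 * y\<^sup>2 = - (2 * int q)] (mod int m)"
      unfolding m_def
    proof (rule solve_quadratic_mod_prod[OF S(1)])
      fix p assume "p \<in> S"
      thus "\<exists>y. [1 * y\<^sup>2 = - (2 * int q)] (mod int p)"
        using S(2) q(6) by (intro solve_quadratic_mod_prime) auto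
    qed (use S in auto)
    then obtain \<beta> where \<beta>: "[1 * \<beta>\<^sup>2 = - (2 * int q)] (mod int m)" by blast
    have "coprime (2 * int q) (int m)" using cop cop2 by simp
    then obtain x r t where xrt: "1 * x\<^sup>2 + 2 * int q * r\<^sup>2 = int m * t\<^sup>2" "t \<noteq> 0"
      using legendre_ternary[of 1 "2 * int q" "int m" \<alpha> \<beta> 0] m0 \<alpha> \<beta> nsq q2 by auto
    hence "2 * x\<^sup>2 + int q * (2 * r)\<^sup>2 = (2 * int m) * t\<^sup>2"
      by (simp add: power2_eq_square algebra_simps)
    from representation_from_rational[OF _ _ this xrt(2) uvs] show ?thesis
      by (simp add: rep2_def m_def)
  qed
qed

lemma nat_square_times_prod_primes:
  assumes "0 < (n::nat)"
  obtains s S where "n = s\<^sup>2 * \<Prod>S" "finite S" "\<And>p. p \<in> S \<Longrightarrow> prime p"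
proof -
  define m where "m = squarefree_part n"
  have m: "squarefree m" "m \<noteq> 0" by (simp_all add: m_def)
  have "m = (\<Prod>p\<in>prime_factors m. p ^ multiplicity p m)"
    using m by (intro prime_factorization_nat) auto
  also have "\<dots> = \<Prod>(prime_factors m)"
    using m by (intro prod.cong) (auto simp: squarefree_factorial_semiring')
  finally have "n = (square_part n)\<^sup>2 * \<Prod>(prime_factors m)"
    using squarefree_decompose[of n] by (simp add: m_def mult.commute)
  thus ?thesis by (rule that) auto
qed

theorem rep1_not_dvd_3:
  assumes "0 \<le> n" "\<not> 3 dvd n"
  shows "rep1 n"
proof -
  have "0 < nat n" using assms by (cases "n = 0") auto
  then obtain s S where sS: "nat n = s\<^sup>2 * \<Prod>S" "finite S" "\<And>p. p \<in> S \<Longrightarrow> prime p"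
    by (rule nat_square_times_prod_primes) blast
  have n: "n = (int s)\<^sup>2 * int (\<Prod>S)"
    using assms(1) sS(1) by (metis int_nat_eq of_nat_mult of_nat_power)
  have "3 \<notin> S"
  proof
    assume "3 \<in> S"
    hence "3 dvd \<Prod>S" using dvd_prodI[OF sS(2), of 3 "\<lambda>p. p"] by simp
    hence "int 3 dvd int (\<Prod>S)" by (simp only: int_dvd_int_iff)
    thus False using assms n by simp
  qed
  thus ?thesis unfolding n using sS by (intro rep1_scale rep1_prod) auto
qed

text \<open>If the squarefree part is 2m, then 4 not dividing n forces s odd, so s^2 = 1 mod 8 and n
  = 2m mod 16: the excluded case m = 5 mod 8 is exactly n = 10 mod 16.\<close>

theorem rep2_not_dvd_4:
  assumes "0 \<le> n" "\<not> 4 dvd n" "n mod 16 \<noteq> 10"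
  shows "rep2 n"
proof -
  have "0 < nat n" using assms by (cases "n = 0") auto
  then obtain s S where sS: "nat n = s\<^sup>2 * \<Prod>S" "finite S" "\<And>p. p \<in> S \<Longrightarrow> prime p"
    by (rule nat_square_times_prod_primes) blast
  define S' where "S' = S - {2}"
  have S': "prime p \<and> 2 < p" if "p \<in> S'" for p
    using sS that prime_ge_2_nat[of p] by (auto simp: S'_def le_neq_implies_less)
  have "finite S'" using sS by (simp add: S'_def)
  note S' = this S'
  have n: "n = (int s)\<^sup>2 * int (\<Prod>S)"
    using assms(1) sS(1) by (metis int_nat_eq of_nat_mult of_nat_power)
  show ?thesis
  proof (cases "2 \<in> S")
    case False
    hence "S' = S" by (auto simp: S'_def)
    thus ?thesis unfolding n using rep2_prod(1)[of S'] sS S' by (intro rep2_scale) auto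
  next
    case True
    define m where "m = int (\<Prod>S')"
    have prod: "int (\<Prod>S) = 2 * m"
      using sS(2) True by (simp add: m_def S'_def prod.remove[of S 2])
    have "odd (int s)"
    proof
      assume "even (int s)"
      hence "4 dvd (int s)\<^sup>2" by (auto simp: power2_eq_square elim!: evenE)
      thus False using assms(2) n by simp
    qed
    have "m mod 8 \<noteq> 5"
    proof
      assume "m mod 8 = 5"
      then obtain k where k: "m = 8 * k + 5" by (metis mult_div_mod_eq)
      obtain j where j: "int s = 2 * j + 1" using \<open>odd (int s)\<close> by (rule oddE)
      have "even (j * (j + 1))" by simp
      then obtain i where i: "j * (j + 1) = 2 * i" by blast
      have "(int s)\<^sup>2 = 4 * (j * (j + 1)) + 1" by (simp add: j power2_eq_square algebra_simps)
      hence "n = (8 * i + 1) * (2 * (8 * k + 5))" using n prod k i by simp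
      hence "n = 16 * (8 * i * k + 5 * i + k) + 10" by (simp add: algebra_simps)
      moreover have "(16 * u + 10) mod 16 = 10" for u :: int by simp
      ultimately show False using assms(3) by blast
    qed
    moreover have "m mod 8 = int (\<Prod>S' mod 8)" unfolding m_def zmod_int by simp
    ultimately have "\<Prod>S' mod 8 \<noteq> 5" by auto
    hence "rep2 (2 * m)" unfolding m_def using S' by (intro rep2_prod(2)) auto
    thus ?thesis unfolding n prod by (rule rep2_scale)
  qed
qed

section \<open>The quaternary forms\<close>

lemma represents_iff: "represents a b c n \<longleftrightarrow> (\<exists>x y z w. n = a * x\<^sup>2 + b * y\<^sup>2 + c * eisenstein_norm z w)"
  by (simp add: represents_def f_form_def eisenstein_norm_def)

lemma represents_scale: "represents a b c n \<Longrightarrow> represents a b c (s\<^sup>2 * n)"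
proof -
  assume "represents a b c n"
  then obtain x y z w where "n = a * x\<^sup>2 + b * y\<^sup>2 + c * eisenstein_norm z w"
    unfolding represents_iff by blast
  hence "s\<^sup>2 * n = a * (s * x)\<^sup>2 + b * (s * y)\<^sup>2 + c * eisenstein_norm (s * z) (s * w)"
    by (simp add: eisenstein_norm_scale power_mult_distrib algebra_simps)
  thus ?thesis unfolding represents_iff by blast
qed

text \<open>Always applied with s = 2, so that only n not divisible by 4 need be represented, as in
  \<open>rep2_not_dvd_4\<close>.\<close>

lemma universal_descent:
  assumes "1 < s" and step: "\<And>n. 0 < n \<Longrightarrow> \<not> s\<^sup>2 dvd n \<Longrightarrow> represents a b c n"
  shows "universal a b c"
proof -
  have "represents a b c n" if "0 \<le> n" for n :: int
    using that
  proof (induction "nat n" arbitrary: n rule: less_induct)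
    case less
    show ?case
    proof (cases "s\<^sup>2 dvd n \<and> n \<noteq> 0")
      case True
      then obtain k where k: "n = s\<^sup>2 * k" by blast
      have "1 < s\<^sup>2" using assms(1) one_less_power[of s 2] by simp
      hence "0 < k" "k < n" using k True less.prems by (auto simp: zero_le_mult_iff)
      hence "represents a b c k" using less by simp
      thus ?thesis unfolding k by (rule represents_scale)
    next
      case False
      have "represents a b c 0"
        unfolding represents_iff by (intro exI[of _ 0]) (simp add: eisenstein_norm_def)
      thus ?thesis using False less.prems step[of n] by (cases "n = 0") auto
    qed
  qed
  thus ?thesis by (simp add: universal_def)
qed

lemma represents_rep1:
  assumes "rep1 (n - b * y\<^sup>2)"
  shows "represents 1 b 1 n"
proof -
  obtain x z w where "n - b * y\<^sup>2 = x\<^sup>2 + eisenstein_norm z w" using assms unfolding rep1_def by blast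
  hence "n = 1 * x\<^sup>2 + b * y\<^sup>2 + 1 * eisenstein_norm z w" by simp
  thus ?thesis unfolding represents_iff by blast
qed

lemma represents_rep2:
  assumes "rep2 (n - b * y\<^sup>2)"
  shows "represents 2 b 1 n"
proof -
  obtain x z w where "n - b * y\<^sup>2 = 2 * x\<^sup>2 + eisenstein_norm z w" using assms unfolding rep2_def by blast
  hence "n = 2 * x\<^sup>2 + b * y\<^sup>2 + 1 * eisenstein_norm z w" by simp
  thus ?thesis unfolding represents_iff by blast
qed

text \<open>The prime 2 is inert in the Eisenstein integers.\<close>

lemma eisenstein_norm_even:
  assumes "even (eisenstein_norm z w)"
  obtains z' w' where "eisenstein_norm z w = 4 * eisenstein_norm z' w'"
proof -
  have "even z \<and> even w"
    using assms unfolding eisenstein_norm_def by (cases "even z"; cases "even w") auto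
  then obtain z' w' where "z = 2 * z'" "w = 2 * w'" by (auto elim!: evenE)
  thus ?thesis using that[of z' w'] by (simp add: eisenstein_norm_def power2_eq_square)
qed

text \<open>The prime 3 ramifies: N = (z - w)^2 mod 3, and 3 | z - w allows division by an element
  of norm 3.\<close>

lemma eisenstein_norm_dvd_3:
  assumes "3 dvd eisenstein_norm z w"
  obtains z' w' where "eisenstein_norm z w = 3 * eisenstein_norm z' w'"
proof -
  have "eisenstein_norm z w = (z - w)\<^sup>2 + 3 * (z * w)"
    by (simp add: eisenstein_norm_def power2_eq_square algebra_simps)
  hence "3 dvd (z - w)\<^sup>2" using assms by (simp add: dvd_add_left_iff)
  hence "3 dvd z - w" by (simp add: prime_dvd_power_iff)
  then obtain k where "z = w + 3 * k" by (metis add.commute diff_add_cancel dvdE)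
  hence "eisenstein_norm z w = 3 * eisenstein_norm k (w + k)"
    by (simp add: eisenstein_norm_def power2_eq_square algebra_simps)
  thus ?thesis by (rule that)
qed

lemma eisenstein_norm_times_3: "\<exists>z' w'. 3 * eisenstein_norm z w = eisenstein_norm z' w'"
  by (intro exI[of _ "z - w"] exI[of _ "z + 2 * w"])
     (simp add: eisenstein_norm_def power2_eq_square algebra_simps)

text \<open>Every Eisenstein integer has an associate in Z[sqrt(-3)], since one of z, w, z + w is
  even.\<close>

lemma eisenstein_norm_eq_square_plus_3_square: "\<exists>u v. eisenstein_norm z w = u\<^sup>2 + 3 * v\<^sup>2"
proof -
  consider "even w" | "even z" | "even (z + w)" by fastforce
  thus ?thesis
  proof cases
    case 1
    then obtain v where "w = 2 * v" by blast
    thus ?thesis by (intro exI[of _ "z + v"] exI[of _ v]) (simp add: eisenstein_norm_def power2_eq_square algebra_simps)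
  next
    case 2
    then obtain v where "z = 2 * v" by blast
    thus ?thesis by (intro exI[of _ "w + v"] exI[of _ v]) (simp add: eisenstein_norm_def power2_eq_square algebra_simps)
  next
    case 3
    then obtain v where "z + w = 2 * v" by blast
    hence w: "w = 2 * v - z" by simp
    show ?thesis unfolding w
      by (intro exI[of _ "z - v"] exI[of _ v]) (simp add: eisenstein_norm_def power2_eq_square algebra_simps)
  qed
qed

text \<open>In a representation of 2n by 2x^2 + N(z, w) both z and w are even.\<close>

lemma half_rep2:
  assumes "rep2 (2 * n)"
  shows "\<exists>x z w. n = x\<^sup>2 + 2 * eisenstein_norm z w"
proof -
  obtain x z w where eq: "2 * n = 2 * x\<^sup>2 + eisenstein_norm z w" using assms unfolding rep2_def by blast
  hence "even (eisenstein_norm z w)" by presburger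
  then obtain z' w' where "eisenstein_norm z w = 4 * eisenstein_norm z' w'" by (rule eisenstein_norm_even)
  hence "n = x\<^sup>2 + 2 * eisenstein_norm z' w'" using eq by simp
  thus ?thesis by blast
qed

lemma represents_half_rep2:
  assumes "rep2 (2 * (n - b * y\<^sup>2))"
  shows "represents 1 b 2 n"
proof -
  obtain x z w where "n - b * y\<^sup>2 = x\<^sup>2 + 2 * eisenstein_norm z w" using half_rep2[OF assms] by blast
  hence "n = 1 * x\<^sup>2 + b * y\<^sup>2 + 2 * eisenstein_norm z w" by simp
  thus ?thesis unfolding represents_iff by blast
qed

section \<open>Universality of the listed forms\<close>

lemma mod_diff_shift: "(n::int) mod m = r \<Longrightarrow> (n - c) mod m = (r - c) mod m"
  by (metis mod_diff_left_eq)

lemma mod_diff_unshift: "((n::int) - c) mod m = r \<Longrightarrow> n mod m = (r + c) mod m"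
  by (metis diff_add_cancel mod_add_left_eq)

lemma rep2_times_4: "rep2 k \<Longrightarrow> rep2 (4 * k)"
  using rep2_scale[of k 2] by simp

lemma rep2_0: "rep2 0"
  unfolding rep2_def by (intro exI[of _ 0]) (simp add: eisenstein_norm_def)

text \<open>One scaling step beyond \<open>rep2_not_dvd_4\<close>: n may also be 4k with k
  admissible there. As 40 mod 64 implies 8 mod 16, the third assumption just says n mod 64 is not
  40; written as a disjunction, it often follows from n mod 16 alone.\<close>

lemma rep2_cases:
  assumes "0 \<le> n" "n mod 16 \<noteq> 10" "n mod 16 \<noteq> 8 \<or> n mod 64 \<noteq> 40" "n mod 16 \<noteq> 0"
  shows "rep2 n"
proof (cases "4 dvd n")
  case False
  thus ?thesis using assms by (intro rep2_not_dvd_4) auto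
next
  case True
  then obtain k where k: "n = 4 * k" by blast
  have h: "n mod 16 = 4 * (k mod 4)" "n mod 64 = 4 * (k mod 16)" 
    using mod_mult_mult1[of 4 k 4] mod_mult_mult1[of 4 k 16] by (simp_all add: k)
  have "n mod 16 = n mod 64 mod 16" by (simp add: mod_mod_cancel)
  hence "n mod 64 = 40 \<Longrightarrow> n mod 16 = 8" by simp
  moreover have "k mod 4 = 0 \<Longrightarrow> n mod 16 = 0" "k mod 16 = 10 \<Longrightarrow> n mod 64 = 40" by (simp_all add: h)
  ultimately have "\<not> 4 dvd k" "k mod 16 \<noteq> 10" using assms(3,4) by (metis dvd_imp_mod_0, metis)
  moreover have "0 \<le> k" using assms k by simp
  ultimately show ?thesis unfolding k by (intro rep2_times_4 rep2_not_dvd_4)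
qed

text \<open>Only multiples of 3 are left. If 3 does not divide b, then y = 1 moves n off them. For b
  = 3, division by 3 exchanges x and y up to a factor 3, as 3N is again a norm, giving a descent.
  For b = 6 it leads to the form 3X^2 + 2y^2 + N, handled by \<open>rep2\<close>.\<close>

lemma universal_1_b_1:
  assumes "b \<in> {1, 2, 3, 4, 5, 6}"
  shows "universal 1 b 1"
proof -
  have not3: "represents 1 b 1 n" if "0 \<le> n" "\<not> 3 dvd n" for n
    using that rep1_not_dvd_3 by (intro represents_rep1[of n b 0]) simp
  consider "b \<in> {1, 2, 4, 5}" | "b = 3" | "b = 6" using assms by auto
  thus ?thesis
  proof cases
    case 1
    show ?thesis
    proof (rule universal_descent[of 2])
      fix n :: int assume n: "0 < n" "\<not> 2\<^sup>2 dvd n"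
      show "represents 1 b 1 n"
      proof (cases "3 dvd n")
        case True
        show ?thesis
        \<comment> \<open>For b = 4 or 5 the number 3 is too small for subtracting b, but 3 = N(1,
          1).\<close>
        proof (cases "n = 3 \<and> b > 3")
          case False
          hence "0 \<le> n - b" using n True 1 by (auto; presburger)
          moreover have "\<not> 3 dvd n - b" using True 1 by (auto; presburger)
          ultimately show ?thesis using rep1_not_dvd_3[of "n - b"] represents_rep1[of n b 1] by simp
        next
          case True
          hence "n = 1 * 0\<^sup>2 + b * 0\<^sup>2 + 1 * eisenstein_norm 1 1" by (simp add: eisenstein_norm_def)
          thus ?thesis unfolding represents_iff by blast
        qed
      qed (use n not3 in auto)
    qed simp
  next
    case 2
    have "represents 1 3 1 n" if "0 \<le> n" for n
      using that
    proof (induction "nat n" arbitrary: n rule: less_induct)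
      case less
      show ?case
      proof (cases "3 dvd n \<and> n \<noteq> 0")
        case True
        then obtain k where k: "n = 3 * k" by blast
        hence "represents 1 3 1 k" using less True by auto
        then obtain x y z w where "k = x\<^sup>2 + 3 * y\<^sup>2 + eisenstein_norm z w" unfolding represents_iff by auto
        hence "n = 1 * (3 * y)\<^sup>2 + 3 * x\<^sup>2 + 1 * (3 * eisenstein_norm z w)" by (simp add: k)
        thus ?thesis unfolding represents_iff using eisenstein_norm_times_3 by metis
      next
        case False
        have "represents 1 3 1 0"
          unfolding represents_iff by (intro exI[of _ 0]) (simp add: eisenstein_norm_def)
        thus ?thesis using False not3[of n] less.prems 2 by auto
      qed
    qed
    thus ?thesis by (simp add: universal_def 2)
  next
    case 3
    show ?thesis unfolding 3
    proof (rule universal_descent[of 2])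
      fix n :: int assume n: "0 < n" "\<not> 2\<^sup>2 dvd n"
      show "represents 1 6 1 n"
      proof (cases "3 dvd n")
        case True
        then obtain k where k: "n = 3 * k" by blast
        have k4: "0 < k" "\<not> 4 dvd k" using n k by (auto simp: dvd_mult)
        have "\<exists>X. rep2 (k - 3 * X\<^sup>2)"
        proof (cases "k mod 16 = 10")
          case True
          hence "rep2 (k - 3)" using k4 by (intro rep2_not_dvd_4) presburger+
          thus ?thesis by (intro exI[of _ 1]) simp
        next
          case False
          thus ?thesis using k4 by (intro exI[of _ 0]) (simp add: rep2_not_dvd_4)
        qed
        then obtain X y z w where "k - 3 * X\<^sup>2 = 2 * y\<^sup>2 + eisenstein_norm z w"
          unfolding rep2_def by blast
        hence "n = 1 * (3 * X)\<^sup>2 + 6 * y\<^sup>2 + 1 * (3 * eisenstein_norm z w)"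
          by (simp add: k power_mult_distrib)
        thus ?thesis unfolding represents_iff using eisenstein_norm_times_3 by metis
      qed (use n not3 3 in auto)
    qed simp
  qed
qed

text \<open>Only n = 10 mod 16 needs y. For b from 3 to 9, n - b is 1 to 7 mod 16. For b = 2, n - 2
  is 8 mod 16 and fails the criterion only if n = 42 mod 64, when n - 8 = 2 mod 16 works. For b =
  10, n - 10 is 0 mod 16, so n - 40 = 2 mod 16 is used; n = 10 and n = 26 are too small for that and
  leave 0 and 16 with y = 1.\<close>

lemma universal_2_b_1:
  assumes "b \<in> {2..10}"
  shows "universal 2 b 1"
proof (rule universal_descent[of 2])
  fix n :: int assume n: "0 < n" "\<not> 2\<^sup>2 dvd n"
  show "represents 2 b 1 n"
  proof (cases "n mod 16 = 10")
    case False
    thus ?thesis using n by (intro represents_rep2[of n b 0] rep2_not_dvd_4) auto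
  next
    case True
    have "\<exists>y. rep2 (n - b * y\<^sup>2)"
    proof (cases "n = b")
      case True
      thus ?thesis using rep2_0 by (intro exI[of _ 1]) simp
    next
      case False
      define j where "j = n div 16"
      have j: "n = 16 * j + 10" using True mult_div_mod_eq[of 16 n] by (simp add: j_def)
      hence "0 \<le> j" using n(1) by linarith
      hence n10: "10 \<le> n" and ten: "n = 10 \<or> n = 26 \<or> 42 \<le> n" using j by presburger+
      note shift = mod_diff_shift[OF True]
      have "b = 2 \<or> b = 10 \<or> b \<in> {3..9}" using assms by auto
      moreover have "b = 10 \<Longrightarrow> n = 26 \<or> 42 \<le> n" using ten False by blast
      ultimately consider "b = 2" "n mod 64 = 42" | "b = 2" "n mod 64 \<noteq> 42" | "b = 10" "n = 26" | "b = 10" "42 \<le> n"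
        | "b \<in> {3..9}"
        by blast
      thus ?thesis
      proof cases
        case 1
        have "rep2 (n - 8)" using n10 shift[of 8] by (intro rep2_cases) simp_all
        thus ?thesis using 1 by (intro exI[of _ 2]) simp
      next
        case 2
        have "(n - 2) mod 64 \<noteq> 40" using 2 mod_diff_unshift[of n 2 64 40] by auto
        hence "rep2 (n - 2)" using n10 shift[of 2] by (intro rep2_cases) simp_all
        thus ?thesis using 2 by (intro exI[of _ 1]) simp
      next
        case 3
        have "rep2 (4 * (4 * 1))" by (intro rep2_times_4 rep2_not_dvd_4) auto
        thus ?thesis using 3 by (intro exI[of _ 1]) simp
      next
        case 4
        have "rep2 (n - 40)" using 4 shift[of 40] by (intro rep2_cases) simp_all
        thus ?thesis using 4 by (intro exI[of _ 2]) simp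
      next
        case 5
        have "(n - b) mod 16 = 10 - b" using 5 shift[of b] by simp
        hence "rep2 (n - b)" using 5 n10 by (intro rep2_cases) auto
        thus ?thesis by (intro exI[of _ 1]) simp
      qed
    qed
    thus ?thesis using represents_rep2 by blast
  qed
qed simp

text \<open>By \<open>half_rep2\<close> the question is whether 2(n - b y^2) is a value of 2x^2 + N,
  so the bad class is n = 5 mod 8. The cases mirror \<open>universal_2_b_1\<close>: b = 1 behaves
  like 2 there, b = 5 like 10, and y = 1 suffices otherwise.\<close>

lemma universal_1_b_2:
  assumes "b \<in> {1, 2, 3, 4, 5}"
  shows "universal 1 b 2"
proof (rule universal_descent[of 2])
  fix n :: int assume n: "0 < n" "\<not> 2\<^sup>2 dvd n"
  show "represents 1 b 2 n"
  proof (cases "n mod 8 = 5")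
    case False
    have "(2 * n) mod 16 = 2 * (n mod 8)" using mod_mult_mult1[of 2 n 8] by simp
    moreover have "\<not> 4 dvd n" using n by simp
    hence "n mod 8 \<noteq> 0" "n mod 8 \<noteq> 4" by presburger+
    ultimately have "rep2 (2 * n)" using n False by (intro rep2_cases) auto
    thus ?thesis by (intro represents_half_rep2[of n b 0]) simp
  next
    case True
    have "\<exists>y. rep2 (2 * (n - b * y\<^sup>2))"
    proof -
      define j where "j = n div 8"
      have j: "n = 8 * j + 5" using True mult_div_mod_eq[of 8 n] by (simp add: j_def)
      hence "0 \<le> j" using n(1) by linarith
      hence n5: "5 \<le> n" and five: "n = 5 \<or> n = 13 \<or> 21 \<le> n" using j by presburger+
      have mod16: "(2 * (n - c)) mod 16 = 2 * ((5 - c) mod 8)" for c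
        using mod_mult_mult1[of 2 "n - c" 8] mod_diff_shift[OF True, of c] by simp
      have mod64: "(2 * (n - c)) mod 64 = 2 * ((n - c) mod 32)" for c
        using mod_mult_mult1[of 2 "n - c" 32] by simp
      have "b = 1 \<or> b = 5 \<or> b \<in> {2..4}" using assms by auto
      then consider "b = 1" "n mod 32 = 21" | "b = 1" "n mod 32 \<noteq> 21" | "b = 5" "n = 5" | "b = 5" "n = 13"
        | "b = 5" "21 \<le> n" | "b \<in> {2..4}"
        using five by blast
      thus ?thesis
      proof cases
        case 1
        have "rep2 (2 * (n - 4))" using n5 mod16[of 4] by (intro rep2_cases) simp_all
        thus ?thesis using 1 by (intro exI[of _ 2]) simp
      next
        case 2
        have "(n - 1) mod 32 \<noteq> 20" using 2 mod_diff_unshift[of n 1 32 20] by auto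
        hence "rep2 (2 * (n - 1))" using n5 mod16[of 1] mod64[of 1] by (intro rep2_cases) simp_all
        thus ?thesis using 2 by (intro exI[of _ 1]) simp
      next
        case 3
        thus ?thesis using rep2_0 by (intro exI[of _ 1]) simp
      next
        case 4
        have "rep2 (4 * (4 * 1))" by (intro rep2_times_4 rep2_not_dvd_4) auto
        thus ?thesis using 4 by (intro exI[of _ 1]) simp
      next
        case 5
        have "rep2 (2 * (n - 20))" using 5 mod16[of 20] by (intro rep2_cases) simp_all
        thus ?thesis using 5 by (intro exI[of _ 2]) simp
      next
        case 6
        have "(2 * (n - b)) mod 16 = 2 * (5 - b)" using 6 mod16[of b] by simp
        hence "rep2 (2 * (n - b))" using 6 n5 by (intro rep2_cases) auto
        thus ?thesis by (intro exI[of _ 1]) simp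
      qed
    qed
    thus ?thesis using represents_half_rep2 by blast
  qed
qed simp

lemma square_mod_3: "(x::int)\<^sup>2 mod 3 \<in> {0, 1}"
proof -
  have "x mod 3 \<in> {0, 1, 2}" by auto
  moreover have "x\<^sup>2 mod 3 = (x mod 3)\<^sup>2 mod 3" by (simp add: power_mod)
  ultimately show ?thesis by auto
qed

lemma eisenstein_norm_mod_3: "eisenstein_norm z w mod 3 \<noteq> 2"
proof -
  have "eisenstein_norm z w mod 3 = (z - w)\<^sup>2 mod 3"
  proof -
    have "eisenstein_norm z w = (z - w)\<^sup>2 + 3 * (z * w)"
      by (simp add: eisenstein_norm_def power2_eq_square algebra_simps)
    thus ?thesis by simp
  qed
  thus ?thesis using square_mod_3[of "z - w"] by auto
qed

text \<open>Norms are never 2 mod 3, so 2y^2 + N = 2 mod 3 forces N to be divisible by 3, hence 3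
  times a norm.\<close>

lemma represents_1_2_3:
  assumes "rep2 (n - x\<^sup>2)" "(n - x\<^sup>2) mod 3 = 2"
  shows "represents 1 2 3 n"
proof -
  obtain y z w where eq: "n - x\<^sup>2 = 2 * y\<^sup>2 + eisenstein_norm z w" using assms unfolding rep2_def by blast
  have "y\<^sup>2 mod 3 = 0 \<or> y\<^sup>2 mod 3 = 1" "eisenstein_norm z w mod 3 \<noteq> 2"
    using square_mod_3[of y] eisenstein_norm_mod_3 by auto
  moreover have "(2 * y\<^sup>2 + eisenstein_norm z w) mod 3 = 2" using assms(2) eq by simp
  ultimately have "3 dvd eisenstein_norm z w" by presburger
  then obtain z' w' where "eisenstein_norm z w = 3 * eisenstein_norm z' w'" by (rule eisenstein_norm_dvd_3)
  hence "n = 1 * x\<^sup>2 + 2 * y\<^sup>2 + 3 * eisenstein_norm z' w'" using eq by simp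
  thus ?thesis unfolding represents_iff by blast
qed

text \<open>A value x^2 + N(z, w) has the shape x^2 + u^2 + 3v^2, where x and u may be exchanged.\<close>

lemma rep1_mod_3:
  assumes "rep1 n" "n mod 3 = 1"
  shows "\<exists>x z w. n = x\<^sup>2 + 3 * eisenstein_norm z w"
proof -
  obtain x z w where "n = x\<^sup>2 + eisenstein_norm z w" using assms unfolding rep1_def by blast
  then obtain u v where eq: "n = x\<^sup>2 + (u\<^sup>2 + 3 * v\<^sup>2)" using eisenstein_norm_eq_square_plus_3_square by metis
  have shape: "\<exists>x z w. n = x\<^sup>2 + 3 * eisenstein_norm z w"
    if eq: "n = x\<^sup>2 + (u\<^sup>2 + 3 * v\<^sup>2)" and "3 dvd u\<^sup>2" for x u v
  proof -
    have "3 dvd u" using that(2) by (simp add: prime_dvd_power_iff)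
    then obtain k where "u = 3 * k" by blast
    hence "n = x\<^sup>2 + 3 * eisenstein_norm (v - k) (2 * k)"
      using eq by (simp add: eisenstein_norm_def power2_eq_square algebra_simps)
    thus ?thesis by blast
  qed
  have "x\<^sup>2 mod 3 = 0 \<or> x\<^sup>2 mod 3 = 1" "u\<^sup>2 mod 3 = 0 \<or> u\<^sup>2 mod 3 = 1"
    using square_mod_3[of x] square_mod_3[of u] by auto
  moreover have "(x\<^sup>2 + (u\<^sup>2 + 3 * v\<^sup>2)) mod 3 = 1" using assms(2) eq by simp
  ultimately have "3 dvd u\<^sup>2 \<or> 3 dvd x\<^sup>2" by presburger
  moreover have "n = u\<^sup>2 + (x\<^sup>2 + 3 * v\<^sup>2)" using eq by simp
  ultimately show ?thesis using shape[OF eq] shape[of u x v] by blast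
qed

text \<open>For n = 2 mod 3 the subtracted x^2 must be divisible by 3 (x = 0 or 3), for n = 0 mod 3
  it must be 1 mod 3 (x = 1 or 2). In the latter case a bad residue 10, 8, 0 of n - 1 mod 16 makes n
  - 4 equal to 7, 5, 13.\<close>

lemma universal_1_2_3: "universal 1 2 3"
proof (rule universal_descent[of 2])
  fix n :: int assume "0 < n" "\<not> 2\<^sup>2 dvd n"
  hence n: "0 < n" "\<not> 4 dvd n" by auto
  consider "n mod 3 = 1" | "n mod 3 = 2" | "n mod 3 = 0" by fastforce
  thus "represents 1 2 3 n"
  proof cases
    case 1
    hence "rep1 n" using n by (intro rep1_not_dvd_3) auto
    then obtain x z w where "n = x\<^sup>2 + 3 * eisenstein_norm z w" using rep1_mod_3 1 by blast
    hence "n = 1 * x\<^sup>2 + 2 * 0\<^sup>2 + 3 * eisenstein_norm z w" by simp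
    thus ?thesis unfolding represents_iff by blast
  next
    case 2
    show ?thesis
    proof (cases "n mod 16 = 10")
      case True
      hence "10 \<le> n" using n by presburger
      hence "rep2 (n - 9)" using mod_diff_shift[OF True, of 9] by (intro rep2_cases) simp_all
      moreover have "(n - 9) mod 3 = 2" using mod_diff_shift[OF 2, of 9] by simp
      ultimately show ?thesis by (intro represents_1_2_3[of n 3]) simp_all
    next
      case False
      hence "rep2 n" using n by (intro rep2_not_dvd_4) auto
      thus ?thesis using 2 by (intro represents_1_2_3[of n 0]) simp_all
    qed
  next
    case 3
    have mod3: "(n - 1) mod 3 = 2" "(n - 4) mod 3 = 2"
      using mod_diff_shift[OF 3, of 1] mod_diff_shift[OF 3, of 4] by simp_all
    show ?thesis
    proof (cases "(n - 1) mod 16 \<in> {10, 8, 0}")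
      case False
      hence "rep2 (n - 1)" using n by (intro rep2_cases) auto
      thus ?thesis using mod3 by (intro represents_1_2_3[of n 1]) simp_all
    next
      case True
      moreover have "(n - 4) mod 16 = ((n - 1) mod 16 - 3) mod 16"
        using mod_diff_shift[of "n - 1" 16 _ 3, OF refl] by simp
      ultimately have "(n - 4) mod 16 \<in> {7, 5, 13}" by auto
      moreover have "4 \<le> n"
      proof -
        have "n \<noteq> 1" "n \<noteq> 2" "n \<noteq> 3" using 3 True by auto
        thus ?thesis using n(1) by linarith
      qed
      ultimately have "rep2 (n - 4)" by (intro rep2_cases) auto
      thus ?thesis using mod3 by (intro represents_1_2_3[of n 2]) simp_all
    qed
  qed
qed simp

lemma represents_1_2_4:
  assumes "rep2 (n - x\<^sup>2)" "even (n - x\<^sup>2)"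
  shows "represents 1 2 4 n"
proof -
  obtain k where k: "n - x\<^sup>2 = 2 * k" using assms(2) by blast
  then obtain y z w where "k = y\<^sup>2 + 2 * eisenstein_norm z w" using half_rep2 assms(1) by metis
  hence "n = 1 * x\<^sup>2 + 2 * y\<^sup>2 + 4 * eisenstein_norm z w" using k by simp
  thus ?thesis unfolding represents_iff by blast
qed

text \<open>By \<open>half_rep2\<close> it is enough that n - x^2 is even and a value of 2x^2 + N,
  so x must have the parity of n. The delicate residues are 9 and 1 mod 16, where n - 1 is 8(2j + 1)
  or 16j; x = 5 or x = 3 replaces x = 1 when the cofactor is bad.\<close>

lemma universal_1_2_4: "universal 1 2 4"
proof (rule universal_descent[of 2])
  fix n :: int assume "0 < n" "\<not> 2\<^sup>2 dvd n"
  hence n: "0 < n" "\<not> 4 dvd n" by auto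
  define j r where "j = n div 16" and "r = n mod 16"
  have nj: "n = 16 * j + r" "0 \<le> r" "r < 16" by (simp_all add: j_def r_def)
  hence "0 \<le> j" using n(1) by linarith
  have r: "n mod 16 = r" by (simp add: r_def)
  note shift = mod_diff_shift[OF r]
  consider "even r" "r \<noteq> 10" | "r = 10" | "odd r" "r \<noteq> 11" "r \<noteq> 9" "r \<noteq> 1" | "r = 11" | "r = 9" "j mod 4 \<noteq> 2"
    | "r = 9" "j mod 4 = 2" | "r = 1" "j = 0" | "r = 1" "odd j" | "r = 1" "even j" "1 \<le> j"
    using \<open>0 \<le> j\<close> by fastforce
  thus "represents 1 2 4 n"
  proof cases
    case 1
    have "rep2 n" using n 1 r by (intro rep2_not_dvd_4) auto
    moreover have "even n" using 1 nj by simp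
    ultimately show ?thesis by (intro represents_1_2_4[of n 0]) simp_all
  next
    case 2
    have "rep2 (n - 4)" using nj 2 \<open>0 \<le> j\<close> shift[of 4] by (intro rep2_cases) simp_all
    thus ?thesis using nj 2 by (intro represents_1_2_4[of n 2]) simp_all
  next
    case 3
    have "r \<in> {3, 5, 7, 13, 15}" using 3 nj by (simp; presburger)
    hence "(n - 1) mod 16 \<in> {2, 4, 6, 12, 14}" using shift[of 1] by auto
    hence "rep2 (n - 1)" using n by (intro rep2_cases) auto
    thus ?thesis using nj 3 by (intro represents_1_2_4[of n 1]) simp_all
  next
    case 4
    have "rep2 (n - 9)" using nj 4 \<open>0 \<le> j\<close> shift[of 9] by (intro rep2_cases) simp_all
    thus ?thesis using nj 4 by (intro represents_1_2_4[of n 3]) simp_all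
  next
    case 5
    have eq: "n - 1 = 4 * (2 * (2 * j + 1))" using nj 5 by simp
    have "(2 * (2 * j + 1)) mod 16 \<noteq> 10" using 5 by presburger
    moreover have "\<not> 4 dvd 2 * (2 * j + 1)" by presburger
    ultimately have "rep2 (n - 1)" unfolding eq using \<open>0 \<le> j\<close> by (intro rep2_times_4 rep2_not_dvd_4) auto
    thus ?thesis using nj 5 by (intro represents_1_2_4[of n 1]) simp_all
  next
    case 6
    define i where "i = j div 4"
    have i: "j = 4 * i + 2" using 6 mult_div_mod_eq[of 4 j] by (simp add: i_def)
    have eq: "n - 25 = 4 * (4 * (4 * i + 1))" using nj 6 i by simp
    have "\<not> 4 dvd 4 * i + 1" "(4 * i + 1) mod 16 \<noteq> 10" "0 \<le> 4 * i + 1" using i \<open>0 \<le> j\<close> by presburger+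
    hence "rep2 (n - 25)" unfolding eq by (intro rep2_times_4 rep2_not_dvd_4)
    thus ?thesis using nj 6 by (intro represents_1_2_4[of n 5]) simp_all
  next
    case 7
    thus ?thesis using nj rep2_0 by (intro represents_1_2_4[of n 1]) simp_all
  next
    case 8
    have eq: "n - 1 = 4 * (4 * j)" using nj 8 by simp
    have "\<not> 4 dvd j" "j mod 16 \<noteq> 10" using 8 by presburger+
    hence "rep2 (n - 1)" unfolding eq using \<open>0 \<le> j\<close> by (intro rep2_times_4 rep2_not_dvd_4)
    thus ?thesis using nj 8 by (intro represents_1_2_4[of n 1]) simp_all
  next
    case 9
    then obtain i where i: "j = 2 * i" by blast
    have eq: "n - 9 = 4 * (2 * (4 * i - 1))" using nj 9 i by simp
    have "\<not> 4 dvd 2 * (4 * i - 1)" "(2 * (4 * i - 1)) mod 16 \<noteq> 10" by presburger+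
    hence "rep2 (n - 9)" unfolding eq using 9 i by (intro rep2_times_4 rep2_not_dvd_4) auto
    thus ?thesis using nj 9 by (intro represents_1_2_4[of n 3]) simp_all
  qed
qed simp

section \<open>Small values and the exclusion of all other forms\<close>

lemma eisenstein_norm_small:
  assumes "eisenstein_norm z w \<le> 10"
  shows "eisenstein_norm z w \<in> {0, 1, 3, 4, 7, 9}"
proof -
  let ?N = "eisenstein_norm z w"
  have "?N \<noteq> 6" "?N \<noteq> 10"
  proof -
    have "even ?N \<Longrightarrow> 4 dvd ?N" by (metis dvd_triv_left eisenstein_norm_even)
    thus "?N \<noteq> 6" "?N \<noteq> 10" by auto
  qed
  moreover have "?N mod 3 \<noteq> 2" by (rule eisenstein_norm_mod_3)
  moreover have "0 \<le> ?N" by (rule eisenstein_norm_nonneg)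
  moreover have "k = 0 \<or> k = 1 \<or> k = 3 \<or> k = 4 \<or> k = 7 \<or> k = 9"
    if "0 \<le> k" "k \<le> 10" "k \<noteq> 6" "k \<noteq> 10" "k mod 3 \<noteq> 2" for k :: int
    using that by presburger
  ultimately show ?thesis using assms by blast
qed

lemma square_small:
  assumes "(x::int)\<^sup>2 \<le> 10"
  shows "x\<^sup>2 \<in> {0, 1, 4, 9}"
proof -
  have "x\<^sup>2 < 4\<^sup>2" using assms by simp
  hence "\<bar>x\<bar> < 4" using power2_less_imp_less[of "\<bar>x\<bar>" 4] by simp
  hence "x \<in> {-3, -2, -1, 0, 1, 2, 3}" by (simp; presburger)
  thus ?thesis by auto
qed

text \<open>The last three alternatives make the search finite although a, b, c are unbounded: a
  coefficient larger than n cannot contribute.\<close>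

lemma represents_small:
  assumes "represents a b c n" "0 < a" "0 < b" "0 < c" "n \<le> 10"
  obtains X Y K where "n = a * X + b * Y + c * K"
    "X \<in> {0, 1, 4, 9}" "Y \<in> {0, 1, 4, 9}" "K \<in> {0, 1, 3, 4, 7, 9}"
    "X = 0 \<or> a \<le> n" "Y = 0 \<or> b \<le> n" "K = 0 \<or> c \<le> n"
proof -
  obtain x y z w where n: "n = a * x\<^sup>2 + b * y\<^sup>2 + c * eisenstein_norm z w"
    using assms(1) unfolding represents_iff by blast
  have le: "v \<le> k * v" "v = 0 \<or> k \<le> k * v" if "0 < k" "0 \<le> v" for k v :: int
    using that mult_right_mono[of 1 k v] mult_left_mono[of 1 v k] by auto
  have nonneg: "0 \<le> a * x\<^sup>2" "0 \<le> b * y\<^sup>2" "0 \<le> c * eisenstein_norm z w"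
    using assms eisenstein_norm_nonneg by auto
  have "x\<^sup>2 \<le> 10" "y\<^sup>2 \<le> 10" "eisenstein_norm z w \<le> 10"
    using le(1)[OF assms(2), of "x\<^sup>2"] le(1)[OF assms(3), of "y\<^sup>2"]
      le(1)[OF assms(4) eisenstein_norm_nonneg, of z w] zero_le_power2[of x] zero_le_power2[of y]
      nonneg n assms(5) by linarith+
  moreover have "x\<^sup>2 = 0 \<or> a \<le> n" "y\<^sup>2 = 0 \<or> b \<le> n" "eisenstein_norm z w = 0 \<or> c \<le> n"
    using le(2)[OF assms(2), of "x\<^sup>2"] le(2)[OF assms(3), of "y\<^sup>2"]
      le(2)[OF assms(4) eisenstein_norm_nonneg, of z w] zero_le_power2[of x] zero_le_power2[of y]
      nonneg n by linarith+
  ultimately show ?thesis using that[OF n] square_small eisenstein_norm_small by blast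
qed

text \<open>Each test value is missed by a partial form and so bounds the next coefficient: x^2 + N
  misses 6, 2x^2 + N misses 10, x^2 + 2N misses 5, x^2 + y^2 misses 3, and x^2 + 2y^2 misses 5. Two
  survivors remain to be excluded: (1, 1, 3) misses 6 and (1, 2, 5) misses 10.\<close>

lemma escalation:
  fixes a b c :: int
  assumes pos: "0 < a" "0 < b" "0 < c" "a \<le> b"
    and rep: "\<forall>n \<in> {1,2,3,5,6,10}. represents a b c n"
  shows "(a = 1 \<and> c = 1 \<and> b \<le> 6) \<or> (a = 2 \<and> c = 1 \<and> b \<le> 10) \<or> (a = 1 \<and> c = 2 \<and> b \<le> 5) \<or>
    (a = 1 \<and> b = 2 \<and> c = 3) \<or> (a = 1 \<and> b = 2 \<and> c = 4)"
proof -
  have small: "\<exists>X\<in>{0, 1, 4, 9}. \<exists>Y\<in>{0, 1, 4, 9}. \<exists>K\<in>{0, 1, 3, 4, 7, 9}. n = a * X + b * Y + c * K \<and>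
      (X = 0 \<or> a \<le> n) \<and> (Y = 0 \<or> b \<le> n) \<and> (K = 0 \<or> c \<le> n)" if "n \<in> {1, 2, 3, 5, 6, 10}" for n
  proof -
    have "represents a b c n" "n \<le> 10" using rep that by auto
    then obtain X Y K where "n = a * X + b * Y + c * K" "X = 0 \<or> a \<le> n" "Y = 0 \<or> b \<le> n" "K = 0 \<or> c \<le> n"
      "X \<in> {0, 1, 4, 9}" "Y \<in> {0, 1, 4, 9}" "K \<in> {0, 1, 3, 4, 7, 9}"
      using pos by (elim represents_small)
    thus ?thesis by blast
  qed
  have "a \<le> 1 \<or> c \<le> 1"
    using small[of 1] pos by auto
  then consider "c = 1" | "2 \<le> c" "a = 1" using pos by linarith
  thus ?thesis
  proof cases
    case 1
    have "a \<le> 2"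
    proof (rule ccontr)
      assume "\<not> a \<le> 2"
      thus False using small[of 2] pos 1 by auto
    qed
    moreover have "b \<le> 6" if "a = 1"
    proof (rule ccontr)
      assume "\<not> b \<le> 6"
      thus False using small[of 6] that 1 by auto
    qed
    moreover have "b \<le> 10" if "a = 2"
    proof (rule ccontr)
      assume "\<not> b \<le> 10"
      thus False using small[of 10] that 1 by auto
    qed
    moreover have "a = 1 \<or> a = 2" using pos \<open>a \<le> 2\<close> by linarith
    ultimately show ?thesis using 1 by blast
  next
    case 2
    show ?thesis
    proof (cases "c = 2")
      case True
      have "b \<le> 5"
      proof (rule ccontr)
        assume "\<not> b \<le> 5"
        thus False using small[of 5] 2 True by auto
      qed
      thus ?thesis using 2 True by simp
    next
      case False
      hence c: "3 \<le> c" using 2 by simp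
      have "b \<le> 2"
      proof (rule ccontr)
        assume "\<not> b \<le> 2"
        thus False using small[of 2] 2 c by auto
      qed
      hence "b = 1 \<or> b = 2" using pos by linarith
      thus ?thesis
      proof
        assume b: "b = 1"
        have "c \<le> 3"
        proof (rule ccontr)
          assume "\<not> c \<le> 3"
          thus False using small[of 3] 2 b by auto
        qed
        hence "c = 3" using c by simp
        hence False using small[of 6] 2 b by auto
        thus ?thesis ..
      next
        assume b: "b = 2"
        have "c \<le> 5"
        proof (rule ccontr)
          assume "\<not> c \<le> 5"
          thus False using small[of 5] 2 b by auto
        qed
        moreover have "c \<noteq> 5" using small[of 10] 2 b by auto
        ultimately show ?thesis using 2 b c by auto
      qed
    qed
  qed
qed

theorem theorem1p1:
  fixes a b c :: int
  assumes "0 < a" and "0 < b" and "0 < c" and "a \<le> b"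
  shows "(universal a b c \<longleftrightarrow>
            (a = 1 \<and> c = 1 \<and> b \<in> {1,2,3,4,5,6}) \<or>
            (a = 2 \<and> c = 1 \<and> b \<in> {2,3,4,5,6,7,8,9,10}) \<or>
            (a = 1 \<and> c = 2 \<and> b \<in> {1,2,3,4,5}) \<or>
            (a = 1 \<and> b = 2 \<and> c = 3) \<or>
            (a = 1 \<and> b = 2 \<and> c = 4))
       \<and> ((\<forall>n \<in> {1,2,3,5,6,10}. represents a b c n) \<longrightarrow> universal a b c)"
    (is "(_ \<longleftrightarrow> ?list) \<and> (?six \<longrightarrow> _)")
proof -
  have list: "?list" if ?six
    using escalation[OF assms that]
  proof (elim disjE conjE)
    assume "a = 1" "c = 1" "b \<le> 6"
    moreover from this have "b = 1 \<or> b = 2 \<or> b = 3 \<or> b = 4 \<or> b = 5 \<or> b = 6" using assms by presburger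
    ultimately show ?thesis by simp
  next
    assume "a = 2" "c = 1" "b \<le> 10"
    moreover from this have "b = 2 \<or> b = 3 \<or> b = 4 \<or> b = 5 \<or> b = 6 \<or> b = 7 \<or> b = 8 \<or> b = 9 \<or> b = 10"
      using assms by presburger
    ultimately show ?thesis by simp
  next
    assume "a = 1" "c = 2" "b \<le> 5"
    moreover from this have "b = 1 \<or> b = 2 \<or> b = 3 \<or> b = 4 \<or> b = 5" using assms by presburger
    ultimately show ?thesis by simp
  qed simp_all
  have univ: "universal a b c" if ?list
    using that
  proof (elim disjE conjE)
    assume "a = 1" "c = 1" "b \<in> {1,2,3,4,5,6}"
    thus ?thesis using universal_1_b_1[of b] by (simp only:)
  next
    assume "a = 2" "c = 1" "b \<in> {2,3,4,5,6,7,8,9,10}"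
    moreover from this have "b \<in> {2..10}" by auto
    ultimately show ?thesis using universal_2_b_1[of b] by (simp only:)
  next
    assume "a = 1" "c = 2" "b \<in> {1,2,3,4,5}"
    thus ?thesis using universal_1_b_2[of b] by (simp only:)
  qed (simp_all only: universal_1_2_3 universal_1_2_4)
  have six: ?six if "universal a b c"
  proof
    fix n :: int assume "n \<in> {1,2,3,5,6,10}"
    hence "0 \<le> n" by auto
    thus "represents a b c n" using that by (simp only: universal_def)
  qed
  show ?thesis
  proof (intro conjI iffI impI)
    show ?list if "universal a b c" using list[OF six[OF that]] .
    show "universal a b c" if ?list using univ[OF that] .
    show "universal a b c" if ?six using univ[OF list[OF that]] .
  qed
qed

end
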